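(* Let $G$ be a finite connected simple graph, and let $\mathcal{B} = \{\mathbf{f}_1, \mathbf{f}_2, \dots, \mathbf{f}_g\}$ be an integral flow $M$-basis with associated dual Laplacian $\mathcal{L}^*$. Then the number of $z$-superstable flow configurations of $G$ (with respect to $\mathcal{L}^*$) is $|\tau(G)|$, where $\tau(G)$ is the set of spanning trees of $G$.
   Context: Let $G=(V,E)$ be a finite connected undirected simple graph with a fixed orientation of its edges, and let $\partial : \mathbb{R}^E \to \mathbb{R}^V$ be the signed incidence matrix: the column of an edge has an entry $-1$ in the row of one endpoint and $+1$ in the row of the other endpoint (according to the orientation), and $0$ elsewhere. The lattice of integral flows of $G$ is $\mathcal{F}(G) = \mathbb{Z}^E \cap \ker(\partial)$, a free abelian group of rank $g = |E|-|V|+1$. Given a $\mathbb{Z}$-basis $\mathcal{B} = \{\mathbf{f}_1,\dots,\mathbf{f}_g\}$ of $\mathcal{F}(G)$, let $\iota$ be the $|E|\times g$ matrix with columns $\mathbf{f}_1,\dots,\mathbf{f}_g$; the associated dual Laplacian is $\mathcal{L}^* = \iota^T\iota$. An $n\times n$ matrix $L$ is a $Z$-matrix if $L_{ij}\le 0$ for all $i\ne j$. A $Z$-matrix $L$ is a (non-singular) $M$-matrix if all eigenvalues of $L$ have positive real part (equivalently, $L^{-1}$ exists and has all entries non-negative). $\mathcal{B}$ is an integral flow $M$-basis if $\mathcal{L}^*$ is an $M$-matrix. Let $L$ be an $n\times n$ integer $M$-matrix. A configuration $\mathbf{c}\in\mathbb{Z}^n$ with $\mathbf{c}\ge 0$ (entrywise)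 is $z$-superstable with respect to $L$ if for every $\mathbf{z}\in\mathbb{Z}^n$ with $\mathbf{z}\ge 0$ and $\mathbf{z}\ne \mathbf{0}$ there exists $i\in\{1,\dots,n\}$ such that $\mathbf{c}_i - (L\mathbf{z})_i < 0$. The $z$-superstable flow configurations of $G$ are the configurations in $\mathbb{Z}^g$ that are $z$-superstable with respect to $L=\mathcal{L}^*$. *)

theory Defs
  imports
    "Graph_Theory.Digraph_Component"
    "Jordan_Normal_Form.Char_Poly"
    "Jordan_Normal_Form.Matrix_Kernel"
begin

text \<open>
  Finite simple undirected graphs are the \<open>pair_graph\<close>s of the library: finite, loop-free,
  symmetric sets of vertex pairs, so that an undirected edge is a pair of opposite arcs.
  An orientation selects one arc of each such pair. The rows and columns of the incidence
  matrix are numbered by duplicate-free enumerations \<open>vs\<close> of the vertices and \<open>es\<close> of the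
  chosen arcs; in particular \<open>length es\<close> is the number of undirected edges.
\<close>

definition enumerates_vertices :: "'a list \<Rightarrow> 'a pair_pre_digraph \<Rightarrow> bool" where
  "enumerates_vertices vs G \<longleftrightarrow> distinct vs \<and> set vs = pverts G"

definition enumerates_orientation :: "('a \<times> 'a) list \<Rightarrow> 'a pair_pre_digraph \<Rightarrow> bool" where
  "enumerates_orientation es G \<longleftrightarrow>
     distinct es \<and> set es \<subseteq> parcs G \<and>
     (\<forall>(u, v) \<in> parcs G. (u, v) \<in> set es \<longleftrightarrow> (v, u) \<notin> set es)"

text \<open>
  The library predicate \<open>tree\<close> is not suitable for undirected graphs: in a symmetric
  digraph each edge already yields a directed cycle of length 2. The cycles of length at least 3
  are exactly the cycles of the undirected graph.
\<close>

definition undirected_tree :: "'a pair_pre_digraph \<Rightarrow> bool" where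
  "undirected_tree H \<longleftrightarrow>
     pair_graph H \<and> Digraph_Component.connected (with_proj H) \<and>
     \<not> (\<exists>p. pre_digraph.cycle (with_proj H) p \<and> length p \<ge> 3)"

definition spanning_trees :: "'a pair_pre_digraph \<Rightarrow> 'a pair_pre_digraph set" where
  "spanning_trees G = {H. undirected_tree H \<and> spanning (with_proj H) (with_proj G)}"

definition incidence_matrix :: "'a list \<Rightarrow> ('a \<times> 'a) list \<Rightarrow> real mat" where
  "incidence_matrix vs es = mat (length vs) (length es)
     (\<lambda>(i, j). if vs ! i = fst (es ! j) then -1 else if vs ! i = snd (es ! j) then 1 else 0)"

definition flow_lattice :: "'a list \<Rightarrow> ('a \<times> 'a) list \<Rightarrow> int vec set" where
  "flow_lattice vs es =
     {f \<in> carrier_vec (length es). map_vec real_of_int f \<in> mat_kernel (incidence_matrix vs es)}"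

text \<open>Uniqueness of the coefficient vector \<open>a\<close> expresses linear independence over the integers.\<close>

definition is_int_basis :: "nat \<Rightarrow> int vec set \<Rightarrow> int vec list \<Rightarrow> bool" where
  "is_int_basis m F fs \<longleftrightarrow>
     set fs \<subseteq> F \<and>
     (\<forall>f \<in> F. \<exists>!a. a \<in> carrier_vec (length fs) \<and> f = mat_of_cols m fs *\<^sub>v a)"

definition dual_laplacian :: "nat \<Rightarrow> int vec list \<Rightarrow> int mat" where
  "dual_laplacian m fs = transpose_mat (mat_of_cols m fs) * mat_of_cols m fs"

definition Z_matrix :: "real mat \<Rightarrow> bool" where
  "Z_matrix L \<longleftrightarrow>
     square_mat L \<and> (\<forall>i < dim_row L. \<forall>j < dim_row L. i \<noteq> j \<longrightarrow> L $$ (i, j) \<le> 0)"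

definition M_matrix :: "real mat \<Rightarrow> bool" where
  "M_matrix L \<longleftrightarrow>
     Z_matrix L \<and> (\<forall>k. eigenvalue (map_mat complex_of_real L) k \<longrightarrow> Re k > 0)"

definition integral_flow_M_basis :: "'a list \<Rightarrow> ('a \<times> 'a) list \<Rightarrow> int vec list \<Rightarrow> bool" where
  "integral_flow_M_basis vs es fs \<longleftrightarrow>
     is_int_basis (length es) (flow_lattice vs es) fs \<and>
     M_matrix (map_mat real_of_int (dual_laplacian (length es) fs))"

text \<open>The order on vectors is the library's entrywise one.\<close>

definition z_superstable :: "int mat \<Rightarrow> int vec \<Rightarrow> bool" where
  "z_superstable L c \<longleftrightarrow>
     c \<in> carrier_vec (dim_row L) \<and> c \<ge> 0\<^sub>v (dim_row L) \<and>
     (\<forall>z \<in> carrier_vec (dim_row L). z \<ge> 0\<^sub>v (dim_row L) \<and> z \<noteq> 0\<^sub>v (dim_row L) \<longrightarrow>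
        (\<exists>i < dim_row L. c $ i - (L *\<^sub>v z) $ i < 0))"

end

theory Submission
  imports Defs
begin

text \<open>
  Every coset of the image of an integer Gram matrix that is a Z-matrix contains exactly one
  z-superstable configuration. Let \<open>A\<close> have the given flow basis as columns and let \<open>K\<close> have as
  columns the rows of the incidence matrix except that of a root. The flow and the cut lattice are
  orthogonal complements of each other and both transposes are surjective over the integers, so
  \<open>A\<^sup>T a \<leftrightarrow> K\<^sup>T a\<close> for integer vectors \<open>a\<close> identifies the cosets of \<open>A\<^sup>T A\<close> with those of
  \<open>K\<^sup>T K\<close>, the reduced Laplacian. Its z-superstable configurations are the parking functions of the
  graph, which Dhar's burning process counts by the same recursion as spanning trees, viewed as
  acyclic parent maps towards the root.
\<close>

section \<open>Superstable configurations of Gram Z-matrices\<close>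

text \<open>No quotient group is formed: configurations of the two sides are related when they are
  images of a common integer vector. Adding \<open>K *\<^sub>v z\<close> to that vector is invisible
  to \<open>transpose_mat A\<close> and moves the other image through a whole coset of
  \<open>transpose_mat K * K\<close>; likewise with the roles exchanged. The obstacle is
  integrality. Over the rationals the transposes are onto for any basis of the flow space; over the
  integers this rests on having a basis of the flow lattice, whose integral left inverse,
  transposed, supplies preimages. On the graph side recursions are compared, because explicit
  bijections between parking functions and trees usually depend on a chosen order of the
  edges.\<close>

lemma mult_mat_vec_nth_sum:
  assumes "L \<in> carrier_mat r n" "w \<in> carrier_vec n" "i < r"
  shows "(L *\<^sub>v w) $ i = (\<Sum>j<n. L $$ (i,j) * w $ j)"
  using assms by (auto simp: scalar_prod_def atLeast0LessThan intro!: sum.cong)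

lemma gram_quadratic:
  fixes K :: "int mat"
  assumes "K \<in> carrier_mat m n" "x \<in> carrier_vec n" "y \<in> carrier_vec n"
  shows "x \<bullet> ((transpose_mat K * K) *\<^sub>v y) = (K *\<^sub>v x) \<bullet> (K *\<^sub>v y)"
proof -
  have "x \<bullet> ((transpose_mat K * K) *\<^sub>v y) = x \<bullet> (transpose_mat K *\<^sub>v (K *\<^sub>v y))"
    using assms by (subst assoc_mult_mat_vec) auto
  also have "\<dots> = (transpose_mat K *\<^sub>v (K *\<^sub>v y)) \<bullet> x"
    using assms by (intro comm_scalar_prod[of _ n]) auto
  also have "\<dots> = (K *\<^sub>v y) \<bullet> (K *\<^sub>v x)"
    using assms by (intro transpose_vec_mult_scalar) auto
  also have "\<dots> = (K *\<^sub>v x) \<bullet> (K *\<^sub>v y)"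
    using assms by (intro comm_scalar_prod[of _ m]) auto
  finally show ?thesis .
qed

lemma int_scalar_prod_self:
  fixes v :: "int vec"
  shows "v \<bullet> v \<ge> 0" and "v \<bullet> v = 0 \<Longrightarrow> v = 0\<^sub>v (dim_vec v)"
proof -
  show "v \<bullet> v \<ge> 0" by (auto simp: scalar_prod_def intro: sum_nonneg)
  assume "v \<bullet> v = 0"
  then have "(\<Sum>i<dim_vec v. v $ i * v $ i) = 0"
    by (simp add: scalar_prod_def atLeast0LessThan)
  then have "\<forall>i<dim_vec v. v $ i * v $ i = 0"
    by (subst (asm) sum_nonneg_eq_0_iff) auto
  then show "v = 0\<^sub>v (dim_vec v)" by (intro eq_vecI) auto
qed

lemma z_superstableD:
  assumes "z_superstable L c" "L \<in> carrier_mat n n"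
  shows "c \<in> carrier_vec n" "i < n \<Longrightarrow> c $ i \<ge> 0"
proof -
  have "c \<in> carrier_vec n" "0\<^sub>v n \<le> c" using assms unfolding z_superstable_def by simp_all
  then show "c \<in> carrier_vec n" "i < n \<Longrightarrow> c $ i \<ge> 0" by (auto simp: less_eq_vec_def)
qed

text \<open>Firing the positive part \<open>p\<close> of \<open>w\<close> from \<open>s\<close>
  leaves every entry nonnegative, so superstability forces \<open>p = 0\<close>. Where
  \<open>w\<close> is positive, \<open>L *\<^sub>v p\<close> is at most \<open>L *\<^sub>v w\<close>
  and \<open>t\<close> bounds the result from below; elsewhere only off-diagonal entries contribute
  to \<open>L *\<^sub>v p\<close>, and \<open>s\<close> is the bound.\<close>

lemma z_superstable_diff_nonpos:
  fixes L :: "int mat"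
  assumes L: "L \<in> carrier_mat n n"
    and Z: "\<And>i j. i < n \<Longrightarrow> j < n \<Longrightarrow> i \<noteq> j \<Longrightarrow> L $$ (i,j) \<le> 0"
    and s: "z_superstable L s" and t: "z_superstable L t"
    and w: "w \<in> carrier_vec n" and eq: "s = t + L *\<^sub>v w" and k: "k < n"
  shows "w $ k \<le> 0"
proof (rule ccontr)
  assume "\<not> w $ k \<le> 0"
  define p where "p = vec n (\<lambda>i. max 0 (w $ i))"
  have p: "p \<in> carrier_vec n" "p \<ge> 0\<^sub>v n" by (auto simp: p_def less_eq_vec_def)
  have "p $ k \<noteq> 0" using \<open>\<not> w $ k \<le> 0\<close> k by (auto simp: p_def)
  then have "p \<noteq> 0\<^sub>v n" using k by auto
  then obtain i where i: "i < n" "s $ i - (L *\<^sub>v p) $ i < 0"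
    using s p L unfolding z_superstable_def by (metis carrier_matD(1))
  have sum: "(L *\<^sub>v p) $ i = (\<Sum>j<n. L $$ (i,j) * p $ j)" "(L *\<^sub>v w) $ i = (\<Sum>j<n. L $$ (i,j) * w $ j)"
    using mult_mat_vec_nth_sum[OF L p(1) i(1)] mult_mat_vec_nth_sum[OF L w i(1)] .
  have tn: "t $ i \<ge> 0" and sn: "s $ i \<ge> 0"
    using z_superstableD[OF s L] z_superstableD[OF t L] i by auto
  have tc: "t \<in> carrier_vec n" using z_superstableD[OF t L] by simp
  have st: "s $ i = t $ i + (L *\<^sub>v w) $ i" unfolding eq using L i tc by auto
  show False
  proof (cases "w $ i > 0")
    case True
    have "L $$ (i,j) * p $ j \<le> L $$ (i,j) * w $ j" if "j < n" for j
      using True Z[of i j] that i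
      by (cases "i = j") (auto simp: p_def max_def mult_left_mono_neg mult_nonneg_nonpos mult_nonpos_nonpos)
    then have "(L *\<^sub>v p) $ i \<le> (L *\<^sub>v w) $ i" unfolding sum by (intro sum_mono) auto
    then show False using i tn st by auto
  next
    case False
    have "L $$ (i,j) * p $ j \<le> 0" if "j < n" for j
      using False Z[of i j] that i
      by (cases "i = j") (auto simp: p_def max_def mult_nonpos_nonneg)
    then have "(L *\<^sub>v p) $ i \<le> 0" unfolding sum by (intro sum_nonpos) auto
    then show False using i sn by auto
  qed
qed

text \<open>The preceding bound applies to \<open>w\<close> and, with \<open>s\<close> and
  \<open>t\<close> exchanged, to \<open>- w\<close>; hence \<open>w\<close> itself vanishes.\<close>

lemma z_superstable_unique:
  fixes L :: "int mat"
  assumes L: "L \<in> carrier_mat n n"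
    and Z: "\<And>i j. i < n \<Longrightarrow> j < n \<Longrightarrow> i \<noteq> j \<Longrightarrow> L $$ (i,j) \<le> 0"
    and s: "z_superstable L s" and t: "z_superstable L t"
    and w: "w \<in> carrier_vec n" and eq: "s = t + L *\<^sub>v w"
  shows "s = t"
proof -
  have c: "s \<in> carrier_vec n" "t \<in> carrier_vec n" "L *\<^sub>v w \<in> carrier_vec n"
    using z_superstableD[OF s L] z_superstableD[OF t L] L w by auto
  have Lw: "L *\<^sub>v (- w) = - (L *\<^sub>v w)" using L w by auto
  have "t = s + L *\<^sub>v (- w)" unfolding eq Lw using c by (intro eq_vecI) auto
  then have "w $ k = 0" if "k < n" for k
    using z_superstable_diff_nonpos[OF L Z s t w eq that]
      z_superstable_diff_nonpos[OF L Z t s _ _ that, of "- w"] w that by force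
  then have "w = 0\<^sub>v n" using w by (intro eq_vecI) auto
  then have "L *\<^sub>v w = 0\<^sub>v n" using L by (intro eq_vecI) (auto)
  then show ?thesis using eq c by auto
qed

text \<open>The vector will be a weight that every nonzero nonnegative firing decreases. It is a
  multiple of the solution of \<open>L x = 1\<close>; its nonnegativity, an instance of the inverse
  of a positive definite Z-matrix being nonnegative, comes from testing the quadratic form on its
  negative part.\<close>

lemma gram_Z_matrix_positive_vector:
  fixes K :: "int mat"
  assumes K: "K \<in> carrier_mat m n"
    and inj: "\<And>z. z \<in> carrier_vec n \<Longrightarrow> K *\<^sub>v z = 0\<^sub>v m \<Longrightarrow> z = 0\<^sub>v n"
    and L_def: "L = transpose_mat K * K"
    and Z: "\<And>i j. i < n \<Longrightarrow> j < n \<Longrightarrow> i \<noteq> j \<Longrightarrow> L $$ (i,j) \<le> 0"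
  obtains x where "x \<in> carrier_vec n" "\<And>i. i < n \<Longrightarrow> x $ i \<ge> 0" "\<And>i. i < n \<Longrightarrow> (L *\<^sub>v x) $ i \<ge> 1"
proof -
  have L: "L \<in> carrier_mat n n" using K L_def by auto
  have "det L \<noteq> 0"
  proof
    assume "det L = 0"
    then obtain v where v: "v \<in> carrier_vec n" "v \<noteq> 0\<^sub>v n" "L *\<^sub>v v = 0\<^sub>v n"
      using det_0_iff_vec_prod_zero[OF L] by auto
    have "(K *\<^sub>v v) \<bullet> (K *\<^sub>v v) = v \<bullet> (L *\<^sub>v v)" using gram_quadratic[OF K v(1) v(1)] L_def by simp
    also have "\<dots> = 0" using v by auto
    finally have "K *\<^sub>v v = 0\<^sub>v m" using int_scalar_prod_self(2)[of "K *\<^sub>v v"] K by auto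
    then show False using inj v by auto
  qed
  \<comment> \<open>The adjugate keeps the solution integral, and the sign factor makes every entry
    of \<open>L *\<^sub>v y\<close> the absolute value of the determinant.\<close>
  define y where "y = adj_mat L *\<^sub>v vec n (\<lambda>_. sgn (det L))"
  have y: "y \<in> carrier_vec n" using adj_mat(1)[OF L] y_def by auto
  have "L *\<^sub>v y = (det L \<cdot>\<^sub>m 1\<^sub>m n) *\<^sub>v vec n (\<lambda>_. sgn (det L))"
    unfolding y_def adj_mat(2)[OF L, symmetric] using adj_mat(1)[OF L] L by (subst assoc_mult_mat_vec) auto
  also have "\<dots> = det L \<cdot>\<^sub>v vec n (\<lambda>_. sgn (det L))"
    by (intro eq_vecI) (auto simp: scalar_prod_def if_distrib[of "\<lambda>x. det L * x"] if_distrib[of "\<lambda>x. x * sgn (det L)"] cong: if_cong)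
  finally have Ly: "(L *\<^sub>v y) $ i = \<bar>det L\<bar>" if "i < n" for i
    using that by (auto simp: abs_sgn)
  then have Ly1: "(L *\<^sub>v y) $ i \<ge> 1" if "i < n" for i using that \<open>det L \<noteq> 0\<close> by auto
  define q where "q = vec n (\<lambda>i. max 0 (- (y $ i)))"
  have q: "q \<in> carrier_vec n" by (auto simp: q_def)
  have "0 \<le> (K *\<^sub>v q) \<bullet> (K *\<^sub>v q)" by (rule int_scalar_prod_self)
  also have "\<dots> = q \<bullet> (L *\<^sub>v q)" using gram_quadratic[OF K q q] L_def by simp
  also have "\<dots> = (\<Sum>i<n. \<Sum>j<n. q $ i * (L $$ (i,j) * q $ j))"
    using L q by (auto simp: scalar_prod_def atLeast0LessThan mult_mat_vec_nth_sum sum_distrib_left)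
  \<comment> \<open>\<open>q\<close> dominates \<open>- y\<close>, which settles
    \<open>i \<noteq> j\<close> by the sign of the entry, and equals it wherever \<open>q\<close> is
    nonzero, which settles \<open>i = j\<close>.\<close>
  also have "\<dots> \<le> (\<Sum>i<n. \<Sum>j<n. q $ i * (L $$ (i,j) * - y $ j))"
  proof (intro sum_mono)
    fix i j assume "i \<in> {..<n}" "j \<in> {..<n}"
    then have ij: "i < n" "j < n" by auto
    show "q $ i * (L $$ (i,j) * q $ j) \<le> q $ i * (L $$ (i,j) * - y $ j)"
    proof (cases "i = j")
      case True
      then show ?thesis using ij by (auto simp: q_def max_def)
    next
      case False
      then have "L $$ (i,j) * q $ j \<le> L $$ (i,j) * - y $ j"
        using Z[OF ij] ij by (intro mult_left_mono_neg) (auto simp: q_def)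
      moreover have "q $ i \<ge> 0" using ij by (auto simp: q_def)
      ultimately show ?thesis by (rule mult_left_mono)
    qed
  qed
  also have "\<dots> = - (\<Sum>i<n. q $ i * (L *\<^sub>v y) $ i)"
    using mult_mat_vec_nth_sum[OF L y] by (simp add: sum_distrib_left sum_negf)
  finally have le: "(\<Sum>i<n. q $ i * (L *\<^sub>v y) $ i) \<le> 0" by simp
  have nn: "\<forall>i\<in>{..<n}. 0 \<le> q $ i * (L *\<^sub>v y) $ i" using Ly by (auto simp: q_def)
  have "(\<Sum>i<n. q $ i * (L *\<^sub>v y) $ i) = 0" using le sum_nonneg[of "{..<n}"] nn by (meson antisym)
  then have "\<forall>i<n. q $ i * (L *\<^sub>v y) $ i = 0"
    using nn by (subst (asm) sum_nonneg_eq_0_iff) auto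
  then have "\<forall>i<n. q $ i = 0" using Ly \<open>det L \<noteq> 0\<close> by auto
  then have "\<forall>i<n. y $ i \<ge> 0" by (auto simp: q_def)
  then show ?thesis using that[OF y] Ly1 by auto
qed

text \<open>A nonnegative configuration of least weight in the coset is superstable: a nonzero
  \<open>z\<close> that could be fired would lower the weight by
  \<open>x \<bullet> (L z) = z \<bullet> (L x) > 0\<close>, using the symmetry of the Gram matrix
  and \<open>L x \<ge> 1\<close>.\<close>

lemma z_superstable_exists:
  fixes K :: "int mat"
  assumes K: "K \<in> carrier_mat m n"
    and inj: "\<And>z. z \<in> carrier_vec n \<Longrightarrow> K *\<^sub>v z = 0\<^sub>v m \<Longrightarrow> z = 0\<^sub>v n"
    and L_def: "L = transpose_mat K * K"
    and Z: "\<And>i j. i < n \<Longrightarrow> j < n \<Longrightarrow> i \<noteq> j \<Longrightarrow> L $$ (i,j) \<le> 0"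
    and c: "c \<in> carrier_vec n"
  obtains w where "w \<in> carrier_vec n" "z_superstable L (c + L *\<^sub>v w)"
proof -
  obtain x where x: "x \<in> carrier_vec n" "\<And>i. i < n \<Longrightarrow> x $ i \<ge> 0" "\<And>i. i < n \<Longrightarrow> (L *\<^sub>v x) $ i \<ge> 1"
    using gram_Z_matrix_positive_vector[OF K inj L_def Z] by blast
  have L: "L \<in> carrier_mat n n" using K L_def by auto
  define P where "P w \<longleftrightarrow> w \<in> carrier_vec n \<and> (\<forall>i<n. (c + L *\<^sub>v w) $ i \<ge> 0)" for w
  define wt where "wt w = nat (x \<bullet> (c + L *\<^sub>v w))" for w
  \<comment> \<open>The coset meets the nonnegative orthant: entries of \<open>L *\<^sub>v x\<close>
    are at least 1, so this multiple of them outweighs every negative entry of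
    \<open>c\<close>.\<close>
  have "P ((\<Sum>i<n. \<bar>c $ i\<bar>) \<cdot>\<^sub>v x)"
    unfolding P_def
  proof (intro conjI allI impI)
    show "(\<Sum>i<n. \<bar>c $ i\<bar>) \<cdot>\<^sub>v x \<in> carrier_vec n" using x by auto
    fix i assume i: "i < n"
    have "\<bar>c $ i\<bar> \<le> (\<Sum>i<n. \<bar>c $ i\<bar>)" using i by (intro member_le_sum) auto
    also have "\<dots> \<le> (\<Sum>i<n. \<bar>c $ i\<bar>) * (L *\<^sub>v x) $ i"
      using x(3)[OF i] mult_left_mono[of 1 "(L *\<^sub>v x) $ i" "\<Sum>i<n. \<bar>c $ i\<bar>"]
      by (simp add: sum_nonneg)
    finally show "(c + L *\<^sub>v ((\<Sum>i<n. \<bar>c $ i\<bar>) \<cdot>\<^sub>v x)) $ i \<ge> 0"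
      using i L x c by (simp add: mult_mat_vec)
  qed
  then obtain w where w: "P w" and min: "\<And>w'. P w' \<Longrightarrow> wt w \<le> wt w'"
    using ex_has_least_nat[of P _ wt] by blast
  have wc: "w \<in> carrier_vec n" using w by (auto simp: P_def)
  have "z_superstable L (c + L *\<^sub>v w)"
    unfolding z_superstable_def
  proof (intro conjI ballI impI)
    show "c + L *\<^sub>v w \<in> carrier_vec (dim_row L)" using L c wc by auto
    show "c + L *\<^sub>v w \<ge> 0\<^sub>v (dim_row L)" using w L c wc by (auto simp: P_def less_eq_vec_def)
    fix z :: "int vec" assume z: "z \<in> carrier_vec (dim_row L)" "0\<^sub>v (dim_row L) \<le> z \<and> z \<noteq> 0\<^sub>v (dim_row L)"
    then have zc: "z \<in> carrier_vec n" using L by auto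
    show "\<exists>i<dim_row L. (c + L *\<^sub>v w) $ i - (L *\<^sub>v z) $ i < 0"
    proof (rule ccontr)
      assume neg: "\<not> ?thesis"
      have split: "c + L *\<^sub>v (w - z) = (c + L *\<^sub>v w) - L *\<^sub>v z"
        using L c wc zc by (intro eq_vecI) (auto simp: mult_minus_distrib_mat_vec)
      have P': "P (w - z)" unfolding P_def split using neg L wc zc by auto
      have "x \<bullet> (L *\<^sub>v z) = (\<Sum>i<n. z $ i * (L *\<^sub>v x) $ i)"
      proof -
        have "x \<bullet> (L *\<^sub>v z) = (K *\<^sub>v x) \<bullet> (K *\<^sub>v z)" using gram_quadratic[OF K x(1) zc] L_def by simp
        also have "\<dots> = (K *\<^sub>v z) \<bullet> (K *\<^sub>v x)" using K x zc by (intro comm_scalar_prod[of _ m]) auto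
        also have "\<dots> = z \<bullet> (L *\<^sub>v x)" using gram_quadratic[OF K zc x(1)] L_def by simp
        finally show ?thesis using L x by (auto simp: scalar_prod_def atLeast0LessThan)
      qed
      moreover have "(\<Sum>i<n. z $ i * (L *\<^sub>v x) $ i) > 0"
      proof -
        obtain k where k: "k < n" "z $ k \<noteq> 0" using z zc L by (metis carrier_matD(1) carrier_vecD eq_vecI index_zero_vec)
        have zn: "z $ i \<ge> 0" if "i < n" for i using z L that by (auto simp: less_eq_vec_def)
        have nn: "z $ i * (L *\<^sub>v x) $ i \<ge> 0" if "i < n" for i
          using zn[OF that] x(3)[OF that] by simp
        have "0 < z $ k * (L *\<^sub>v x) $ k" using k zn[of k] x(3)[of k] by (simp add: zero_less_mult_iff)
        then show ?thesis using k nn by (intro sum_pos2[of _ k]) auto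
      qed
      moreover have "x \<bullet> (c + L *\<^sub>v (w - z)) = x \<bullet> (c + L *\<^sub>v w) - x \<bullet> (L *\<^sub>v z)"
        unfolding split using L c wc zc x by (intro scalar_prod_minus_distrib[of _ n]) auto
      moreover have "x \<bullet> (c + L *\<^sub>v (w - z)) \<ge> 0"
        using P' x L unfolding P_def scalar_prod_def by (intro sum_nonneg) auto
      ultimately have "wt (w - z) < wt w" by (auto simp: wt_def)
      then show False using min[OF P'] by auto
    qed
  qed
  then show ?thesis using that wc by blast
qed

section \<open>Matching the cosets of two orthogonal lattices\<close>

lemma card_eq_of_biunique:
  assumes "\<And>x. x \<in> X \<Longrightarrow> \<exists>!y. y \<in> Y \<and> R x y" "\<And>y. y \<in> Y \<Longrightarrow> \<exists>!x. x \<in> X \<and> R x y"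
  shows "card X = card Y"
proof -
  define f where "f x = (THE y. y \<in> Y \<and> R x y)" for x
  have f: "f x \<in> Y \<and> R x (f x)" if "x \<in> X" for x
    unfolding f_def using theI'[OF assms(1)[OF that]] .
  have "bij_betw f X Y"
    unfolding bij_betw_def
  proof
    show "inj_on f X" using f assms(2) by (intro inj_onI) metis
    show "f ` X = Y"
    proof
      show "f ` X \<subseteq> Y" using f by auto
      show "Y \<subseteq> f ` X"
      proof
        fix y assume "y \<in> Y"
        then obtain x where "x \<in> X" "R x y" using assms(2) by blast
        then have "f x = y" using f assms(1) \<open>y \<in> Y\<close> by metis
        then show "y \<in> f ` X" using \<open>x \<in> X\<close> by auto
      qed
    qed
  qed
  then show ?thesis by (rule bij_betw_same_card)
qed

text \<open>A preimage \<open>a\<close> of \<open>s\<close> may be shifted by any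
  \<open>K *\<^sub>v w\<close> until its other image is superstable. Conversely two preimages of
  \<open>s\<close> differ by some \<open>K *\<^sub>v z\<close>, so their other images share a coset,
  which has only one superstable member.\<close>

lemma z_superstable_dual_ex1:
  fixes A K :: "int mat"
  assumes A: "A \<in> carrier_mat m g" and K: "K \<in> carrier_mat m n"
    and AK: "\<And>z. z \<in> carrier_vec n \<Longrightarrow> transpose_mat A *\<^sub>v (K *\<^sub>v z) = 0\<^sub>v g"
    and surjA: "\<And>d. d \<in> carrier_vec g \<Longrightarrow> \<exists>a \<in> carrier_vec m. transpose_mat A *\<^sub>v a = d"
    and surjK: "\<And>d. d \<in> carrier_vec n \<Longrightarrow> \<exists>a \<in> carrier_vec m. transpose_mat K *\<^sub>v a = d"
    and ker: "\<And>a. a \<in> carrier_vec m \<Longrightarrow> transpose_mat A *\<^sub>v a = 0\<^sub>v g \<Longrightarrow> \<exists>z \<in> carrier_vec n. a = K *\<^sub>v z"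
    and Z: "\<And>i j. i < n \<Longrightarrow> j < n \<Longrightarrow> i \<noteq> j \<Longrightarrow> (transpose_mat K * K) $$ (i,j) \<le> 0"
    and s: "s \<in> carrier_vec g"
  shows "\<exists>!t. z_superstable (transpose_mat K * K) t \<and>
    (\<exists>a \<in> carrier_vec m. transpose_mat A *\<^sub>v a = s \<and> transpose_mat K *\<^sub>v a = t)"
proof -
  let ?L = "transpose_mat K * K"
  have L: "?L \<in> carrier_mat n n" using K by auto
  have Lz: "?L *\<^sub>v z = transpose_mat K *\<^sub>v (K *\<^sub>v z)" if "z \<in> carrier_vec n" for z
    using that K by (subst assoc_mult_mat_vec) auto
  \<comment> \<open>A matrix whose transpose is onto is injective: \<open>z = K^T a\<close> gives
    \<open>z \<bullet> z = a \<bullet> (K z) = 0\<close>.\<close>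
  have inj: "z = 0\<^sub>v n" if z: "z \<in> carrier_vec n" "K *\<^sub>v z = 0\<^sub>v m" for z
  proof -
    obtain a where a: "a \<in> carrier_vec m" "transpose_mat K *\<^sub>v a = z" using surjK z by blast
    have "z \<bullet> z = (transpose_mat K *\<^sub>v a) \<bullet> z" using a by simp
    also have "\<dots> = a \<bullet> (K *\<^sub>v z)" by (rule transpose_vec_mult_scalar[OF K z(1) a(1)])
    also have "\<dots> = 0" using a z by auto
    finally show ?thesis using int_scalar_prod_self(2)[of z] z(1) by (metis carrier_vecD)
  qed
  obtain a where a: "a \<in> carrier_vec m" "transpose_mat A *\<^sub>v a = s" using surjA s by blast
  have "transpose_mat K *\<^sub>v a \<in> carrier_vec n" using K a by auto
  then obtain w where w: "w \<in> carrier_vec n" "z_superstable ?L (transpose_mat K *\<^sub>v a + ?L *\<^sub>v w)"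
    using z_superstable_exists[OF K inj refl Z] by blast
  have "transpose_mat A *\<^sub>v (a + K *\<^sub>v w) = s"
    using A K a w AK[OF w(1)] s by (subst mult_add_distrib_mat_vec[of _ g m]) auto
  moreover have "transpose_mat K *\<^sub>v (a + K *\<^sub>v w) = transpose_mat K *\<^sub>v a + ?L *\<^sub>v w"
    unfolding Lz[OF w(1)] using K a w by (subst mult_add_distrib_mat_vec[of _ n m]) auto
  moreover have "a + K *\<^sub>v w \<in> carrier_vec m" using a K w by auto
  ultimately have ex: "z_superstable ?L (transpose_mat K *\<^sub>v a + ?L *\<^sub>v w) \<and>
    (\<exists>b \<in> carrier_vec m. transpose_mat A *\<^sub>v b = s \<and> transpose_mat K *\<^sub>v b = transpose_mat K *\<^sub>v a + ?L *\<^sub>v w)"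
    using w by blast
  show ?thesis
  proof (rule ex1I, rule ex, elim conjE bexE)
    fix t b assume t: "z_superstable ?L t" and b: "b \<in> carrier_vec m"
      "transpose_mat A *\<^sub>v b = s" "transpose_mat K *\<^sub>v b = t"
    have "transpose_mat A *\<^sub>v (b - a) = 0\<^sub>v g"
      using A a b s by (subst mult_minus_distrib_mat_vec[of _ g m]) auto
    then obtain z where z: "z \<in> carrier_vec n" "b - a = K *\<^sub>v z" using ker[of "b - a"] a(1) b(1) by auto
    have "t = transpose_mat K *\<^sub>v (a + (b - a))"
    proof -
      have "a + (b - a) = b" using a b by auto
      then show ?thesis using b by simp
    qed
    also have "\<dots> = transpose_mat K *\<^sub>v a + ?L *\<^sub>v z"
      unfolding Lz[OF z(1)] z(2) using K a z(1) by (subst mult_add_distrib_mat_vec[of _ n m]) auto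
    finally have tz: "t = transpose_mat K *\<^sub>v a + ?L *\<^sub>v z" .
    have "?L *\<^sub>v (z - w) = ?L *\<^sub>v z - ?L *\<^sub>v w"
      by (rule mult_minus_distrib_mat_vec[OF L z(1) w(1)])
    then have "t = (transpose_mat K *\<^sub>v a + ?L *\<^sub>v w) + ?L *\<^sub>v (z - w)"
      unfolding tz using K a z w by (intro eq_vecI) auto
    then show "t = transpose_mat K *\<^sub>v a + ?L *\<^sub>v w"
      using z_superstable_unique[OF L Z t w(2), of "z - w"] z w by auto
  qed
qed

lemma card_z_superstable_dual:
  fixes A K :: "int mat"
  assumes A: "A \<in> carrier_mat m g" and K: "K \<in> carrier_mat m n"
    and KA: "\<And>z. z \<in> carrier_vec g \<Longrightarrow> transpose_mat K *\<^sub>v (A *\<^sub>v z) = 0\<^sub>v n"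
    and surjA: "\<And>d. d \<in> carrier_vec g \<Longrightarrow> \<exists>a \<in> carrier_vec m. transpose_mat A *\<^sub>v a = d"
    and surjK: "\<And>d. d \<in> carrier_vec n \<Longrightarrow> \<exists>a \<in> carrier_vec m. transpose_mat K *\<^sub>v a = d"
    and kerA: "\<And>a. a \<in> carrier_vec m \<Longrightarrow> transpose_mat A *\<^sub>v a = 0\<^sub>v g \<Longrightarrow> \<exists>z \<in> carrier_vec n. a = K *\<^sub>v z"
    and kerK: "\<And>a. a \<in> carrier_vec m \<Longrightarrow> transpose_mat K *\<^sub>v a = 0\<^sub>v n \<Longrightarrow> \<exists>z \<in> carrier_vec g. a = A *\<^sub>v z"
    and ZA: "\<And>i j. i < g \<Longrightarrow> j < g \<Longrightarrow> i \<noteq> j \<Longrightarrow> (transpose_mat A * A) $$ (i,j) \<le> 0"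
    and ZK: "\<And>i j. i < n \<Longrightarrow> j < n \<Longrightarrow> i \<noteq> j \<Longrightarrow> (transpose_mat K * K) $$ (i,j) \<le> 0"
  shows "card {c. z_superstable (transpose_mat A * A) c} = card {c. z_superstable (transpose_mat K * K) c}"
proof -
  \<comment> \<open>Orthogonality is symmetric: for \<open>y = A^T (K z)\<close>, the square
    \<open>y \<bullet> y\<close> equals \<open>(K^T (A y)) \<bullet> z\<close>. The hypotheses now
    come in pairs and the correspondence can be used in both directions.\<close>
  have AK: "transpose_mat A *\<^sub>v (K *\<^sub>v z) = 0\<^sub>v g" if z: "z \<in> carrier_vec n" for z
  proof -
    define y where "y = transpose_mat A *\<^sub>v (K *\<^sub>v z)"
    have y: "y \<in> carrier_vec g" using A unfolding y_def by (intro carrier_vecI) simp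
    have "y \<bullet> y = (K *\<^sub>v z) \<bullet> (A *\<^sub>v y)"
      unfolding y_def using A K z by (intro transpose_vec_mult_scalar) auto
    also have "\<dots> = (A *\<^sub>v y) \<bullet> (K *\<^sub>v z)" using A K y z by (intro comm_scalar_prod[of _ m]) auto
    also have "\<dots> = (transpose_mat K *\<^sub>v (A *\<^sub>v y)) \<bullet> z"
      using A K y z by (intro transpose_vec_mult_scalar[symmetric]) auto
    also have "\<dots> = 0" using KA[OF y] z by simp
    finally show ?thesis using int_scalar_prod_self(2)[of y] y unfolding y_def[symmetric] by auto
  qed
  show ?thesis
  proof (rule card_eq_of_biunique)
    let ?R = "\<lambda>s t. \<exists>a \<in> carrier_vec m. transpose_mat A *\<^sub>v a = s \<and> transpose_mat K *\<^sub>v a = t"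
    have L: "transpose_mat A * A \<in> carrier_mat g g" "transpose_mat K * K \<in> carrier_mat n n"
      using A K by auto
    fix s assume "s \<in> {c. z_superstable (transpose_mat A * A) c}"
    then have "s \<in> carrier_vec g" using z_superstableD(1)[OF _ L(1)] by blast
    from z_superstable_dual_ex1[OF A K AK surjA surjK kerA ZK this]
    show "\<exists>!t. t \<in> {c. z_superstable (transpose_mat K * K) c} \<and> ?R s t"
      unfolding mem_Collect_eq .
  next
    let ?R = "\<lambda>s t. \<exists>a \<in> carrier_vec m. transpose_mat A *\<^sub>v a = s \<and> transpose_mat K *\<^sub>v a = t"
    have L: "transpose_mat A * A \<in> carrier_mat g g" "transpose_mat K * K \<in> carrier_mat n n"
      using A K by auto
    fix t assume "t \<in> {c. z_superstable (transpose_mat K * K) c}"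
    then have "t \<in> carrier_vec n" using z_superstableD(1)[OF _ L(2)] by blast
    from z_superstable_dual_ex1[OF K A KA surjK surjA kerK ZA this]
    show "\<exists>!s. s \<in> {c. z_superstable (transpose_mat A * A) c} \<and> ?R s t"
      unfolding mem_Collect_eq by (subst conj_commute)
  qed
qed

section \<open>Burning\<close>

text \<open>\<open>f v x W\<close> reads: a vertex \<open>v\<close> with value \<open>x\<close> catches fire once all of \<open>W\<close> burns.
  Of the burnt set \<open>S\<close>, only \<open>R\<close> has been used so far to test the vertices of \<open>U\<close>; the last
  condition is Dhar's criterion that the fire eventually reaches all of \<open>U\<close>. Splitting the maps
  by the set \<open>B\<close> of vertices ignited next gives a recursion that only involves the numbers of
  values \<open>x\<close> with \<open>f v x W\<close>. Parking functions and acyclic parent maps have the same numbers.\<close>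

definition burning_maps ::
    "('v \<Rightarrow> 'x \<Rightarrow> 'v set \<Rightarrow> bool) \<Rightarrow> 'v set \<Rightarrow> 'v set \<Rightarrow> 'v set \<Rightarrow> ('v \<Rightarrow> 'x) set" where
  "burning_maps f R S U = {c \<in> extensional U.
     (\<forall>v\<in>U. \<not> f v (c v) R) \<and> (\<forall>A\<subseteq>U. A \<noteq> {} \<longrightarrow> (\<exists>v\<in>A. f v (c v) (S \<union> (U - A))))}"

lemma burning_mapsI:
  assumes "c \<in> extensional U" "\<And>v. v \<in> U \<Longrightarrow> \<not> f v (c v) R"
    and "\<And>A. A \<subseteq> U \<Longrightarrow> A \<noteq> {} \<Longrightarrow> \<exists>v\<in>A. f v (c v) (S \<union> (U - A))"
  shows "c \<in> burning_maps f R S U"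
  using assms unfolding burning_maps_def by blast

lemma burning_mapsD:
  assumes "c \<in> burning_maps f R S U"
  shows "c \<in> extensional U" "v \<in> U \<Longrightarrow> \<not> f v (c v) R"
    and "A \<subseteq> U \<Longrightarrow> A \<noteq> {} \<Longrightarrow> \<exists>v\<in>A. f v (c v) (S \<union> (U - A))"
  using assms unfolding burning_maps_def by blast+

text \<open>Already on singletons, Dhar's criterion confines each value to a finite set.\<close>

lemma finite_burning_maps:
  assumes "finite U" "\<And>v. v \<in> U \<Longrightarrow> finite {x. f v x (S \<union> (U - {v}))}"
  shows "finite (burning_maps f R S U)"
proof (rule finite_subset)
  show "burning_maps f R S U \<subseteq> (\<Pi>\<^sub>E v\<in>U. {x. f v x (S \<union> (U - {v}))})"
  proof
    fix c assume c: "c \<in> burning_maps f R S U"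
    have "f v (c v) (S \<union> (U - {v}))" if "v \<in> U" for v
      using burning_mapsD(3)[OF c, of "{v}"] that by blast
    then show "c \<in> (\<Pi>\<^sub>E v\<in>U. {x. f v x (S \<union> (U - {v}))})"
      using burning_mapsD(1)[OF c] by (auto simp: PiE_def)
  qed
  show "finite (\<Pi>\<^sub>E v\<in>U. {x. f v x (S \<union> (U - {v}))})"
    using assms by (intro finite_PiE) auto
qed

text \<open>Once the layer \<open>B\<close> ignited by \<open>S\<close> is fixed, the values on
  \<open>B\<close> are independent: allowed by \<open>S\<close>, not yet by \<open>R\<close>. The
  remaining vertices failed the test with \<open>S\<close> and face the fire
  \<open>S \<union> B\<close>, a problem of the same kind. Sets \<open>A\<close> that meet
  \<open>B\<close> satisfy the criterion at once, since a vertex of \<open>B\<close> burns from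
  \<open>S\<close> alone.\<close>

lemma burning_maps_layer:
  assumes mono: "\<And>v x S T. f v x S \<Longrightarrow> S \<subseteq> T \<Longrightarrow> f v x T" and "R \<subseteq> S" and B: "B \<subseteq> U"
  shows "bij_betw (\<lambda>c. (restrict c B, restrict c (U - B)))
    {c \<in> burning_maps f R S U. {v\<in>U. f v (c v) S} = B}
    ((\<Pi>\<^sub>E v\<in>B. {x. f v x S} - {x. f v x R}) \<times> burning_maps f S (S \<union> B) (U - B))"
proof (rule bij_betwI[where g = "\<lambda>(a, b) v. if v \<in> B then a v else b v"])
  let ?X = "{c \<in> burning_maps f R S U. {v\<in>U. f v (c v) S} = B}"
  let ?Y = "(\<Pi>\<^sub>E v\<in>B. {x. f v x S} - {x. f v x R}) \<times> burning_maps f S (S \<union> B) (U - B)"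
  show "(\<lambda>c. (restrict c B, restrict c (U - B))) \<in> ?X \<rightarrow> ?Y"
  proof
    fix c assume "c \<in> ?X"
    then have c: "c \<in> burning_maps f R S U" and layer: "{v\<in>U. f v (c v) S} = B" by blast+
    have S: "f v (c v) S \<longleftrightarrow> v \<in> B" if "v \<in> U" for v using layer that by blast
    have R: "\<not> f v (c v) R" if "v \<in> U" for v using burning_mapsD(2)[OF c that] .
    have 1: "restrict c B \<in> (\<Pi>\<^sub>E v\<in>B. {x. f v x S} - {x. f v x R})"
      using S R B by (intro restrict_PiE_iff[THEN iffD2] ballI) blast
    have 2: "restrict c (U - B) \<in> burning_maps f S (S \<union> B) (U - B)"
    proof (rule burning_mapsI)
      show "restrict c (U - B) \<in> extensional (U - B)" by simp
      show "\<not> f v (restrict c (U - B) v) S" if "v \<in> U - B" for v using S that by simp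
      fix A assume A: "A \<subseteq> U - B" "A \<noteq> {}"
      then have "A \<subseteq> U" by blast
      then obtain v where v: "v \<in> A" "f v (c v) (S \<union> (U - A))"
        using burning_mapsD(3)[OF c _ A(2)] by blast
      have "S \<union> (U - A) \<subseteq> S \<union> B \<union> (U - B - A)" by blast
      from mono[OF v(2) this] have "f v (restrict c (U - B) v) (S \<union> B \<union> (U - B - A))"
        using v(1) A by (metis restrict_apply' subsetD)
      then show "\<exists>v\<in>A. f v (restrict c (U - B) v) (S \<union> B \<union> (U - B - A))" using v(1) by blast
    qed
    from 1 2 show "(restrict c B, restrict c (U - B)) \<in> ?Y" by (rule SigmaI)
  qed
  show "(\<lambda>(a, b) v. if v \<in> B then a v else b v) \<in> ?Y \<rightarrow> ?X"
  proof (clarify)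
    fix a b assume a: "a \<in> (\<Pi>\<^sub>E v\<in>B. {x. f v x S} - {x. f v x R})"
      and b: "b \<in> burning_maps f S (S \<union> B) (U - B)"
    let ?c = "\<lambda>v. if v \<in> B then a v else b v"
    have aS: "f v (a v) S" "\<not> f v (a v) R" if "v \<in> B" for v using PiE_mem[OF a that] by blast+
    have bS: "\<not> f v (b v) S" if "v \<in> U" "v \<notin> B" for v
      using burning_mapsD(2)[OF b, of v] that by blast
    have "?c \<in> burning_maps f R S U"
    proof (rule burning_mapsI)
      show "?c \<in> extensional U"
        using PiE_arb[OF a] extensional_arb[OF burning_mapsD(1)[OF b]] B
        by (auto simp: extensional_def)
      show "\<not> f v (?c v) R" if "v \<in> U" for v
        using aS(2)[of v] bS[of v] mono[of v "b v" R S] \<open>R \<subseteq> S\<close> that by (cases "v \<in> B") auto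
      fix A assume A: "A \<subseteq> U" "A \<noteq> {}"
      show "\<exists>v\<in>A. f v (?c v) (S \<union> (U - A))"
      proof (cases "A \<inter> B = {}")
        case True
        then have "A \<subseteq> U - B" using A by blast
        then obtain v where v: "v \<in> A" "f v (b v) (S \<union> B \<union> (U - B - A))"
          using burning_mapsD(3)[OF b _ A(2)] by blast
        moreover have "S \<union> B \<union> (U - B - A) = S \<union> (U - A)" using True B by blast
        moreover have "?c v = b v" using True v(1) by auto
        ultimately show ?thesis by (intro bexI[of _ v]) simp_all
      next
        case False
        then obtain v where v: "v \<in> A" "v \<in> B" by blast
        have "f v (a v) (S \<union> (U - A))" using mono[OF aS(1)[OF v(2)]] by blast
        then show ?thesis using v by (intro bexI[of _ v]) simp_all
      qed
    qed
    moreover have "{v\<in>U. f v (?c v) S} = B"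
    proof (rule Set.set_eqI, rule iffI)
      fix v assume "v \<in> {v\<in>U. f v (?c v) S}"
      then show "v \<in> B" using bS[of v] by (cases "v \<in> B") simp_all
    next
      fix v assume "v \<in> B"
      then show "v \<in> {v\<in>U. f v (?c v) S}" using aS(1)[of v] B by auto
    qed
    ultimately show "?c \<in> burning_maps f R S U \<and> {v\<in>U. f v (?c v) S} = B" by (rule conjI)
  qed
  show "(\<lambda>(a, b) v. if v \<in> B then a v else b v) (restrict c B, restrict c (U - B)) = c" if "c \<in> ?X" for c
  proof -
    have "c \<in> extensional U" using that burning_mapsD(1) by blast
    then show ?thesis using B by (auto simp: fun_eq_iff extensional_def)
  qed
  show "(\<lambda>c. (restrict c B, restrict c (U - B))) ((\<lambda>(a, b) v. if v \<in> B then a v else b v) y) = y"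
    if y: "y \<in> ?Y" for y
  proof -
    obtain a b where ab: "y = (a, b)" by (cases y)
    have "a \<in> extensional B" using y ab by (auto simp: PiE_def)
    moreover have "b \<in> extensional (U - B)" using y ab burning_mapsD(1)[of b] by blast
    ultimately show ?thesis unfolding ab by (auto simp: fun_eq_iff extensional_def)
  qed
qed

text \<open>The empty layer is excluded because the criterion for \<open>A = U\<close> leaves only
  \<open>S\<close> to ignite some vertex. This also makes the recursion terminate.\<close>

lemma card_burning_maps_layers:
  assumes mono: "\<And>v x S T. f v x S \<Longrightarrow> S \<subseteq> T \<Longrightarrow> f v x T" and RS: "R \<subseteq> S"
    and U: "finite U" "U \<noteq> {}" and fin: "\<And>v S. v \<in> U \<Longrightarrow> finite {x. f v x S}"
  shows "card (burning_maps f R S U) = (\<Sum>B\<in>Pow U - {{}}.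
    (\<Prod>v\<in>B. card {x. f v x S} - card {x. f v x R}) * card (burning_maps f S (S \<union> B) (U - B)))"
proof -
  let ?X = "\<lambda>B. {c \<in> burning_maps f R S U. {v\<in>U. f v (c v) S} = B}"
  have ne: "{v\<in>U. f v (c v) S} \<noteq> {}" if "c \<in> burning_maps f R S U" for c
    using burning_mapsD(3)[OF that, of U] U by auto
  have "burning_maps f R S U = (\<Union>B\<in>Pow U - {{}}. ?X B)" using ne by auto
  then have "card (burning_maps f R S U) = card (\<Union>B\<in>Pow U - {{}}. ?X B)" by simp
  also have "\<dots> = (\<Sum>B\<in>Pow U - {{}}. card (?X B))"
    using finite_burning_maps[OF U(1) fin] U by (intro card_UN_disjoint) auto
  also have "\<dots> = (\<Sum>B\<in>Pow U - {{}}.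
    (\<Prod>v\<in>B. card {x. f v x S} - card {x. f v x R}) * card (burning_maps f S (S \<union> B) (U - B)))"
  proof (rule sum.cong[OF refl])
    fix B assume "B \<in> Pow U - {{}}"
    then have B: "B \<subseteq> U" "finite B" using U finite_subset by auto
    have "card (?X B) = card ((\<Pi>\<^sub>E v\<in>B. {x. f v x S} - {x. f v x R}) \<times> burning_maps f S (S \<union> B) (U - B))"
      by (rule bij_betw_same_card[OF burning_maps_layer[where f = f, OF mono RS B(1)]])
    also have "\<dots> = (\<Prod>v\<in>B. card ({x. f v x S} - {x. f v x R})) * card (burning_maps f S (S \<union> B) (U - B))"
      using B by (simp add: card_cartesian_product card_PiE)
    also have "(\<Prod>v\<in>B. card ({x. f v x S} - {x. f v x R})) = (\<Prod>v\<in>B. card {x. f v x S} - card {x. f v x R})"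
      using fin mono RS B by (intro prod.cong refl card_Diff_subset) auto
    finally show "card (?X B) = (\<Prod>v\<in>B. card {x. f v x S} - card {x. f v x R}) * card (burning_maps f S (S \<union> B) (U - B))" .
  qed
  finally show ?thesis .
qed

lemma card_burning_maps_cong:
  assumes "\<And>v x S T. f v x S \<Longrightarrow> S \<subseteq> T \<Longrightarrow> f v x T" "\<And>v x S T. g v x S \<Longrightarrow> S \<subseteq> T \<Longrightarrow> g v x T"
    and "R \<subseteq> S" "finite U"
    and "\<And>v S. v \<in> U \<Longrightarrow> finite {x. f v x S}" "\<And>v S. v \<in> U \<Longrightarrow> finite {x. g v x S}"
    and "\<And>v S. v \<in> U \<Longrightarrow> card {x. f v x S} = card {x. g v x S}"
  shows "card (burning_maps f R S U) = card (burning_maps g R S U)"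
  using assms(3-)
proof (induction "card U" arbitrary: R S U rule: less_induct)
  case less
  show ?case
  proof (cases "U = {}")
    case True
    then show ?thesis by (simp add: burning_maps_def)
  next
    case False
    have *: "card (burning_maps f S (S \<union> B) (U - B)) = card (burning_maps g S (S \<union> B) (U - B))"
      if "B \<in> Pow U - {{}}" for B
    proof -
      have "U - B \<subset> U" using that by auto
      then show ?thesis using less.prems by (intro less.hyps) (auto intro: psubset_card_mono)
    qed
    have **: "(\<Prod>v\<in>B. card {x. f v x S} - card {x. f v x R}) = (\<Prod>v\<in>B. card {x. g v x S} - card {x. g v x R})"
      if "B \<in> Pow U - {{}}" for B
      using that less.prems(5) by (intro prod.cong refl) auto
    have "card (burning_maps f R S U) = (\<Sum>B\<in>Pow U - {{}}.
      (\<Prod>v\<in>B. card {x. f v x S} - card {x. f v x R}) * card (burning_maps f S (S \<union> B) (U - B)))"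
      by (rule card_burning_maps_layers; fact assms(1) less.prems(1,2,3) False)
    moreover have "card (burning_maps g R S U) = (\<Sum>B\<in>Pow U - {{}}.
      (\<Prod>v\<in>B. card {x. g v x S} - card {x. g v x R}) * card (burning_maps g S (S \<union> B) (U - B)))"
      by (rule card_burning_maps_layers; fact assms(2) less.prems(1,2,4) False)
    moreover have "(\<Sum>B\<in>Pow U - {{}}.
        (\<Prod>v\<in>B. card {x. f v x S} - card {x. f v x R}) * card (burning_maps f S (S \<union> B) (U - B))) =
      (\<Sum>B\<in>Pow U - {{}}.
        (\<Prod>v\<in>B. card {x. g v x S} - card {x. g v x R}) * card (burning_maps g S (S \<union> B) (U - B)))"
      by (intro sum.cong refl arg_cong2[where f = "(*)"] * **)
    ultimately show ?thesis by (simp only:)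
  qed
qed

section \<open>Trees as parent maps\<close>

lemma pawalk_verts_eq: "pcas u c v \<Longrightarrow> pawalk_verts u c = map fst c @ [v]"
  by (induction c arbitrary: u) auto

lemma pcas_append: "pcas u (xs @ ys) v \<longleftrightarrow> (\<exists>w. pcas u xs w \<and> pcas w ys v)"
  by (induction xs arbitrary: u) auto

definition parent_graph :: "'a set \<Rightarrow> 'a \<Rightarrow> ('a \<Rightarrow> 'a) \<Rightarrow> 'a pair_pre_digraph" where
  "parent_graph V q p = \<lparr> pverts = V,
     parcs = (\<lambda>v. (v, p v)) ` (V - {q}) \<union> (\<lambda>v. (p v, v)) ` (V - {q}) \<rparr>"

text \<open>Acyclicity is stated as well-foundedness, in the shape that Dhar's criterion takes when
  a vertex burns as soon as its parent does.\<close>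

locale parent_map =
  fixes V :: "'a set" and q :: 'a and p :: "'a \<Rightarrow> 'a"
  assumes finite_V: "finite V" and root: "q \<in> V"
    and parent_in: "\<And>v. v \<in> V - {q} \<Longrightarrow> p v \<in> V"
    and parent_acyclic: "\<And>A. A \<subseteq> V - {q} \<Longrightarrow> A \<noteq> {} \<Longrightarrow> \<exists>v\<in>A. p v \<notin> A"
begin

abbreviation "H \<equiv> parent_graph V q p"

lemma parent_graph_arcs: "(a, b) \<in> parcs H \<longleftrightarrow> a \<in> V - {q} \<and> b = p a \<or> b \<in> V - {q} \<and> a = p b"
  by (auto simp: parent_graph_def)

lemma pverts_parent_graph [simp]: "pverts H = V"
  by (simp add: parent_graph_def)

lemma pair_graph_parent_graph: "pair_graph H"
proof
  show "fst e \<in> pverts H" "snd e \<in> pverts H" if "e \<in> parcs H" for e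
    using that parent_in by (auto simp: parent_graph_def) blast+
  show "finite (pverts H)" "finite (parcs H)" using finite_V by (auto simp: parent_graph_def)
  show "fst e \<noteq> snd e" if e: "e \<in> parcs H" for e
  proof -
    have "p v \<noteq> v" if "v \<in> V - {q}" for v using parent_acyclic[of "{v}"] that by auto
    then show ?thesis using e by (auto simp: parent_graph_def) metis+
  qed
  show "Digraph.symmetric (with_proj H)"
    unfolding Digraph.symmetric_def by (auto intro!: symI simp: parent_graph_arcs)
qed

text \<open>The vertices that cannot reach the root would form a set closed under taking
  parents.\<close>

lemma parent_graph_reachable_root:
  assumes "v \<in> V"
  shows "v \<rightarrow>\<^sup>*\<^bsub>with_proj H\<^esub> q"
proof (rule ccontr)
  interpret H: pair_graph H by (rule pair_graph_parent_graph)
  assume contr: "\<not> ?thesis"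
  define A where "A = {v \<in> V. \<not> v \<rightarrow>\<^sup>*\<^bsub>with_proj H\<^esub> q}"
  have "q \<rightarrow>\<^sup>*\<^bsub>with_proj H\<^esub> q" using root by auto
  then have A: "A \<subseteq> V - {q}" unfolding A_def by blast
  have "v \<in> A" using contr assms unfolding A_def by simp
  then have "A \<noteq> {}" by blast
  then obtain w where w: "w \<in> A" "p w \<notin> A" using parent_acyclic[OF A] by blast
  then have wV: "w \<in> V - {q}" using A by blast
  then have "p w \<rightarrow>\<^sup>*\<^bsub>with_proj H\<^esub> q" using w(2) parent_in[OF wV] unfolding A_def by simp
  moreover have "(w, p w) \<in> parcs H" unfolding parent_graph_arcs using wV by blast
  ultimately have "w \<rightarrow>\<^sup>*\<^bsub>with_proj H\<^esub> q"
    using H.adj_reachable_trans[of w "p w" q] by simp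
  then show False using w(1) unfolding A_def by simp
qed

lemma parent_graph_reachable:
  assumes "u \<in> V" "v \<in> V"
  shows "u \<rightarrow>\<^sup>*\<^bsub>with_proj H\<^esub> v"
proof -
  interpret H: pair_graph H by (rule pair_graph_parent_graph)
  show ?thesis
    using H.reachable_trans[OF parent_graph_reachable_root[OF assms(1)]]
      H.symmetric_reachable'[OF parent_graph_reachable_root[OF assms(2)]] by blast
qed

lemma connected_parent_graph: "Digraph_Component.connected (with_proj H)"
proof -
  interpret H: pair_graph H by (rule pair_graph_parent_graph)
  show ?thesis
    using root parent_graph_reachable H.reachable_mk_symmetricI by (intro H.connectedI) auto
qed

text \<open>A deepest vertex of \<open>C\<close>. Acyclicity makes the parent-to-child relation
  well-founded, which only yields highest vertices; finiteness passes well-foundedness on to the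
  converse.\<close>

lemma leaf_exists:
  assumes "C \<noteq> {}"
  obtains z where "z \<in> C" "\<And>w. w \<in> C \<Longrightarrow> w \<in> V - {q} \<Longrightarrow> p w \<noteq> z"
proof -
  let ?r = "(\<lambda>v. (p v, v)) ` (V - {q})"
  have "wf ?r"
  proof (rule wfI_min)
    fix x :: 'a and Q assume x: "x \<in> Q"
    show "\<exists>z\<in>Q. \<forall>y. (y, z) \<in> ?r \<longrightarrow> y \<notin> Q"
    proof (cases "Q \<subseteq> V - {q}")
      case True
      then obtain v where "v \<in> Q" "p v \<notin> Q" using parent_acyclic[of Q] x by auto
      then show ?thesis by (intro bexI[of _ v]) auto
    next
      case False
      then obtain v where "v \<in> Q" "v \<notin> V - {q}" by blast
      then show ?thesis by (intro bexI[of _ v]) auto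
    qed
  qed
  then have "wf (?r\<inverse>)" using finite_V by (intro finite_acyclic_wf_converse wf_acyclic) auto
  then obtain z where z: "z \<in> C" "\<And>y. (y, z) \<in> ?r\<inverse> \<Longrightarrow> y \<notin> C"
    using assms wfE_min[of "?r\<inverse>"] by (metis ex_in_conv)
  show ?thesis
  proof (rule that[OF z(1)])
    fix w assume "w \<in> C" "w \<in> V - {q}"
    then show "p w \<noteq> z" using z(2)[of w] by auto
  qed
qed

text \<open>On a cycle pick a vertex of maximal depth: both of its cycle neighbours are its parent.\<close>

lemma parent_graph_no_cycle:
  assumes "pre_digraph.cycle (with_proj H) c"
  shows "length c < 3"
proof (rule ccontr)
  assume "\<not> length c < 3"
  interpret H: pair_graph H by (rule pair_graph_parent_graph)
  obtain u where u: "H.awalk u c u" "distinct (tl (pawalk_verts u c))" "c \<noteq> []"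
    using assms unfolding H.cycle_def by auto
  have cas: "pcas u c u" and arcs: "set c \<subseteq> parcs H" using u(1) by (auto simp: H.awalk_def)
  have dist: "distinct (map fst c)"
    using u(2,3) cas unfolding pawalk_verts_eq[OF cas] by (cases c) auto
  obtain z where z: "z \<in> fst ` set c" "\<And>w. w \<in> fst ` set c \<Longrightarrow> w \<in> V - {q} \<Longrightarrow> p w \<noteq> z"
    using leaf_exists[of "fst ` set c"] u(3) by auto
  then obtain c1 c2 w where c: "c = c1 @ (z, w) # c2"
    by (metis imageE prod.collapse split_list)
  \<comment> \<open>Read cyclically, \<open>c2 @ c1\<close> leads from \<open>w\<close> back to
    \<open>z\<close>. Length at least 3 makes its first and last arcs different, so their tails
    \<open>w\<close> and \<open>d\<close>, the two cycle neighbours of \<open>z\<close>, are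
    distinct.\<close>
  obtain a b c3 where c3: "c2 @ c1 = (a, b) # c3"
    using \<open>\<not> length c < 3\<close> c by (cases "c2 @ c1") auto
  have "length c = Suc (length (c2 @ c1))" using c by simp
  then have "c3 \<noteq> []" using \<open>\<not> length c < 3\<close> unfolding c3 by (cases c3) auto
  then obtain c4 d e where c4: "c3 = c4 @ [(d, e)]" by (metis rev_exhaust surj_pair)
  have "pcas z ((z, w) # c2 @ c1) z"
  proof -
    obtain y where "pcas u c1 y" "pcas y ((z, w) # c2) u" using cas unfolding c pcas_append by blast
    then have "pcas u c1 z" "pcas w c2 u" by simp_all
    then have "pcas w (c2 @ c1) z" unfolding pcas_append by blast
    then show ?thesis unfolding append_Cons pcas.simps fst_conv snd_conv by simp
  qed
  then have aw: "a = w" and "pcas b (c4 @ [(d, e)]) z" unfolding c3 c4 by simp_all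
  then have ez: "e = z" unfolding pcas_append by auto
  have set: "set c = insert (z, w) (set (c2 @ c1))" using c by auto
  then have mem: "(z, w) \<in> set c" "(w, b) \<in> set c" "(d, z) \<in> set c"
    unfolding c3 c4 using aw ez by auto
  have "distinct (map fst (c2 @ c1))" using dist unfolding c by auto
  then have "w \<noteq> d" unfolding c3 c4 using aw by auto
  moreover have "w = p z" using mem(1,2) z(2)[of w] arcs parent_graph_arcs[of z w] by force
  moreover have "d = p z" using mem(3) z(2)[of d] arcs parent_graph_arcs[of d z] by force
  ultimately show False by simp
qed

lemma undirected_tree_parent_graph: "undirected_tree H"
  unfolding undirected_tree_def
  using pair_graph_parent_graph connected_parent_graph parent_graph_no_cycle not_less by blast

end

text \<open>The set where \<open>p\<close> and \<open>p'\<close> differ is closed under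
  \<open>p\<close>: the arc from \<open>v\<close> to \<open>p v\<close> must come from
  \<open>p' (p v) = v\<close>, while \<open>p (p v) = v\<close> would be a 2-cycle of
  parents.\<close>

lemma parent_graph_inj:
  assumes "parent_map V q p" "parent_map V q p'" "parent_graph V q p = parent_graph V q p'"
    and "v \<in> V - {q}"
  shows "p v = p' v"
proof (rule ccontr)
  interpret p: parent_map V q p by fact
  interpret p': parent_map V q p' by fact
  assume "p v \<noteq> p' v"
  let ?A = "{v \<in> V - {q}. p v \<noteq> p' v}"
  have "p v \<in> ?A" if v: "v \<in> ?A" for v
  proof -
    have "(v, p v) \<in> parcs (parent_graph V q p')"
      using v p.parent_graph_arcs[of v "p v"] assms(3) by auto
    then have pv: "p v \<in> V - {q}" "p' (p v) = v" using v p'.parent_graph_arcs by auto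
    have "p (p v) \<noteq> v"
      using p.parent_acyclic[of "{v, p v}"] v pv by auto
    then show ?thesis using pv by auto
  qed
  then show False using p.parent_acyclic[of ?A] assms(4) \<open>p v \<noteq> p' v\<close> by blast
qed

text \<open>The parent is a neighbour closer to the root, with \<open>d\<close> the distance to
  \<open>q\<close>. The resulting parent graph is a connected spanning subgraph, so a further edge
  of \<open>T\<close> would close a cycle.\<close>

lemma undirected_tree_parent_map:
  assumes T: "undirected_tree T" and q: "q \<in> pverts T"
  obtains p where "parent_map (pverts T) q p" "parent_graph (pverts T) q p = T"
proof -
  interpret T: pair_graph T using T by (simp add: undirected_tree_def)
  have conn: "u \<rightarrow>\<^sup>*\<^bsub>with_proj T\<^esub> v" if "u \<in> pverts T" "v \<in> pverts T" for u v
    using T that T.symmetric_connected_imp_strongly_connected T.pair_sym_arcs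
    by (auto simp: undirected_tree_def)
  define d where "d v = (LEAST n. (v, q) \<in> parcs T ^^ n)" for v
  have "\<exists>w. (v, w) \<in> parcs T \<and> d w < d v" if v: "v \<in> pverts T - {q}" for v
  proof -
    have "(v, q) \<in> (parcs T)\<^sup>*" using conn[of v q] v q reachable_rtranclI[of "with_proj T" v q] by auto
    then have "\<exists>n. (v, q) \<in> parcs T ^^ n" by (simp add: rtrancl_power)
    then have dv: "(v, q) \<in> parcs T ^^ d v" unfolding d_def by (rule LeastI_ex)
    have "d v \<noteq> 0" using dv v by (intro notI) auto
    then obtain n where n: "d v = Suc n" by (cases "d v") auto
    then obtain w where w: "(v, w) \<in> parcs T" "(w, q) \<in> parcs T ^^ n"
      using dv relpow_Suc_D2[of v q n "parcs T"] by auto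
    have "d w \<le> n" unfolding d_def using w(2) by (rule Least_le)
    then show ?thesis using w n by auto
  qed
  then obtain p where p: "\<And>v. v \<in> pverts T - {q} \<Longrightarrow> (v, p v) \<in> parcs T \<and> d (p v) < d v" by metis
  interpret P: parent_map "pverts T" q p
  proof
    show "finite (pverts T)" by (rule T.pair_finite_verts)
    show "q \<in> pverts T" by (rule q)
    show "p v \<in> pverts T" if "v \<in> pverts T - {q}" for v using p[OF that] T.in_arcsD2 by blast
    fix A assume A: "A \<subseteq> pverts T - {q}" "A \<noteq> {}"
    then obtain v where "v \<in> A" "\<And>w. w \<in> A \<Longrightarrow> d v \<le> d w"
      using ex_has_least_nat[of "\<lambda>v. v \<in> A" _ d] by blast
    then show "\<exists>v\<in>A. p v \<notin> A" using p[of v] A by (intro bexI[of _ v]) force+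
  qed
  interpret PH: pair_graph P.H by (rule P.pair_graph_parent_graph)
  have sub: "parcs P.H \<subseteq> parcs T"
  proof
    fix e assume "e \<in> parcs P.H"
    then obtain a b where "e = (a, b)" "(a, b) \<in> parcs P.H" by (cases e) auto
    then show "e \<in> parcs T"
      using p[of a] p[of b] T.arcs_symmetric[of b a] P.parent_graph_arcs[of a b] by auto
  qed
  have "parcs T \<subseteq> parcs P.H"
  proof (rule ccontr)
    assume "\<not> ?thesis"
    then obtain u v where uv: "(u, v) \<in> parcs T" "(u, v) \<notin> parcs P.H" by auto
    then have mem: "u \<in> pverts T" "v \<in> pverts T" "u \<noteq> v"
      using T.wellformed'[of u v] T.pair_no_loops[of "(u, v)"] by auto
    then obtain c where c: "PH.apath u c v"
      using P.parent_graph_reachable PH.reachable_apath by blast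
    then have cas: "pcas u c v" and cH: "set c \<subseteq> parcs P.H" and dist: "distinct (pawalk_verts u c)"
      by (auto simp: PH.apath_def PH.awalk_def)
    \<comment> \<open>The arc from \<open>u\<close> to \<open>v\<close> is missing in the parent
      graph, so the path between them has an inner vertex and the closed walk has the length that
      counts as an undirected cycle.\<close>
    have len: "length c \<ge> 2"
    proof (cases c)
      case Nil
      then show ?thesis using cas mem by simp
    next
      case (Cons e c')
      then show ?thesis using cas cH uv by (cases c'; cases e) auto
    qed
    have cas': "pcas u (c @ [(v, u)]) u"
      unfolding pcas_append using cas by (intro exI[of _ v]) simp
    moreover have "set (c @ [(v, u)]) \<subseteq> parcs T"
      using cH sub T.arcs_symmetric[OF uv(1)] by auto
    ultimately have "T.awalk u (c @ [(v, u)]) u" using mem(1) unfolding T.awalk_def by blast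
    moreover have "distinct (tl (pawalk_verts u (c @ [(v, u)])))"
      using dist cas len unfolding pawalk_verts_eq[OF cas'] pawalk_verts_eq[OF cas]
      by (cases c) auto
    ultimately have "T.cycle (c @ [(v, u)])" unfolding T.cycle_def by (intro exI[of _ u]) simp
    moreover have "length (c @ [(v, u)]) \<ge> 3" using len by simp
    ultimately show False using T unfolding undirected_tree_def by blast
  qed
  then have "P.H = T" using sub by (intro pair_pre_digraph.equality) (auto)
  then show ?thesis using that P.parent_map_axioms by blast
qed

section \<open>Flows, cuts and the reduced Laplacian\<close>

lemma transpose_mult_vec_nth:
  assumes "K \<in> carrier_mat m n" "i < n"
  shows "(transpose_mat K *\<^sub>v a) $ i = col K i \<bullet> a"
  using assms by simp

text \<open>The transposed form of \<open>U A = 1\<close>, checked against unit vectors: an integral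
  left inverse of \<open>A\<close> makes \<open>transpose_mat A\<close> onto over the
  integers.\<close>

lemma transpose_retraction:
  fixes A :: "int mat"
  assumes A: "A \<in> carrier_mat m g" and U: "U \<in> carrier_mat g m"
    and UA: "\<And>x. x \<in> carrier_vec g \<Longrightarrow> U *\<^sub>v (A *\<^sub>v x) = x" and d: "d \<in> carrier_vec g"
  shows "transpose_mat A *\<^sub>v (transpose_mat U *\<^sub>v d) = d"
proof (intro eq_vecI)
  fix i assume "i < dim_vec d"
  then have i: "i < g" using d by simp
  let ?x = "unit_vec g i"
  let ?e = "transpose_mat A *\<^sub>v (transpose_mat U *\<^sub>v d)"
  have e: "?e \<in> carrier_vec g" using A by (intro carrier_vecI) simp
  have "?e \<bullet> ?x = (transpose_mat U *\<^sub>v d) \<bullet> (A *\<^sub>v ?x)"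
    using A U d by (intro transpose_vec_mult_scalar) auto
  also have "\<dots> = d \<bullet> (U *\<^sub>v (A *\<^sub>v ?x))"
    using A U d by (intro transpose_vec_mult_scalar) auto
  also have "\<dots> = d \<bullet> ?x" using UA by simp
  finally show "?e $ i = d $ i" using i d e by simp
qed (use A d in simp)

text \<open>Splitting the vertex list as \<open>q # us\<close> fixes the root and lets
  \<open>us\<close> index the reduced Laplacian.\<close>

locale oriented_graph =
  fixes G :: "'a pair_pre_digraph" and q :: 'a and us :: "'a list" and es :: "('a \<times> 'a) list"
  assumes graph: "pair_graph G" and conn: "Digraph_Component.connected (with_proj G)"
    and vertices: "enumerates_vertices (q # us) G" and orientation: "enumerates_orientation es G"
begin

sublocale G: pair_graph G by (rule graph)

abbreviation "m \<equiv> length es"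
abbreviation "n \<equiv> length us"

text \<open>The integer form of a row of \<open>incidence_matrix\<close>, indexed by the vertex
  itself. The difference of indicators agrees with the nested conditional there because arcs have
  distinct ends.\<close>

definition incidence_row :: "'a \<Rightarrow> int vec" where
  "incidence_row v = vec m (\<lambda>j. of_bool (snd (es ! j) = v) - of_bool (fst (es ! j) = v))"

definition cut_matrix :: "int mat" where
  "cut_matrix = mat_of_cols m (map incidence_row us)"

lemma dim_incidence_row [simp]: "dim_vec (incidence_row v) = m"
  by (simp add: incidence_row_def)

lemma incidence_row_carrier [simp]: "incidence_row v \<in> carrier_vec m"
  by (simp add: incidence_row_def)

lemma incidence_row_nth [simp]:
  "j < m \<Longrightarrow> incidence_row v $ j = of_bool (snd (es ! j) = v) - of_bool (fst (es ! j) = v)"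
  by (simp add: incidence_row_def)

lemma dim_cut_matrix [simp]: "dim_row cut_matrix = m" "dim_col cut_matrix = n"
  by (simp_all add: cut_matrix_def)

lemma cut_matrix_carrier: "cut_matrix \<in> carrier_mat m n"
  by (rule carrier_matI) simp_all

lemma col_cut_matrix [simp]: "i < n \<Longrightarrow> col cut_matrix i = incidence_row (us ! i)"
  by (simp add: cut_matrix_def)

lemma pverts_eq: "pverts G = insert q (set us)" and distinct_us: "distinct us" and root_notin: "q \<notin> set us"
  using vertices by (auto simp: enumerates_vertices_def)

lemma es_arc: "j < m \<Longrightarrow> es ! j \<in> parcs G"
  using orientation nth_mem[of j es] by (auto simp: enumerates_orientation_def)

lemma es_ends:
  assumes "j < m"
  shows "fst (es ! j) \<in> pverts G" "snd (es ! j) \<in> pverts G" "fst (es ! j) \<noteq> snd (es ! j)"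
  using es_arc[OF assms] G.arc_fst_in_verts G.arc_snd_in_verts G.pair_no_loops by auto

text \<open>The coboundary of \<open>h\<close> on edge \<open>j\<close>; for constant
  \<open>h\<close> it says that the incidence rows sum to zero.\<close>

lemma sum_incidence_row:
  assumes "j < m"
  shows "(\<Sum>v\<in>pverts G. incidence_row v $ j * h v) = h (snd (es ! j)) - h (fst (es ! j))"
proof -
  have "(\<Sum>v\<in>pverts G. incidence_row v $ j * h v) =
    (\<Sum>v\<in>pverts G. (if snd (es ! j) = v then h v else 0) - (if fst (es ! j) = v then h v else 0))"
    using assms by (intro sum.cong) auto
  also have "\<dots> = h (snd (es ! j)) - h (fst (es ! j))"
    using es_ends[OF assms] G.pair_finite_verts by (simp add: sum_subtractf)
  finally show ?thesis .
qed

lemma flow_lattice_iff: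
  "f \<in> flow_lattice (q # us) es \<longleftrightarrow> f \<in> carrier_vec m \<and> (\<forall>v\<in>pverts G. incidence_row v \<bullet> f = 0)"
proof -
  let ?M = "incidence_matrix (q # us) es"
  have "(?M *\<^sub>v map_vec real_of_int f) $ i = real_of_int (incidence_row ((q # us) ! i) \<bullet> f)"
    if "f \<in> carrier_vec m" "i < Suc n" for i
    using that es_ends(3) es_ends(3)[symmetric]
    by (auto simp: incidence_matrix_def scalar_prod_def intro!: sum.cong)
  then have "?M *\<^sub>v map_vec real_of_int f = 0\<^sub>v (Suc n) \<longleftrightarrow>
      (\<forall>i<Suc n. incidence_row ((q # us) ! i) \<bullet> f = 0)" if "f \<in> carrier_vec m"
    using that by (auto simp: vec_eq_iff incidence_matrix_def)
  moreover have "(\<forall>i<Suc n. incidence_row ((q # us) ! i) \<bullet> f = 0) \<longleftrightarrow>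
      (\<forall>v\<in>pverts G. incidence_row v \<bullet> f = 0)"
    unfolding pverts_eq using all_set_conv_all_nth[of "q # us" "\<lambda>v. incidence_row v \<bullet> f = 0"] by simp
  moreover have "f \<in> flow_lattice (q # us) es \<longleftrightarrow>
      f \<in> carrier_vec m \<and> ?M *\<^sub>v map_vec real_of_int f = 0\<^sub>v (Suc n)"
    unfolding flow_lattice_def mat_kernel_def by (auto simp: incidence_matrix_def)
  ultimately show ?thesis by blast
qed

text \<open>\<open>P\<close> is the signed arc count of a walk from the root to \<open>v\<close>,
  built along reachability; an arc traversed against its orientation is subtracted.\<close>

lemma path_vector_exists:
  assumes "v \<in> pverts G"
  shows "\<exists>P \<in> carrier_vec m. \<forall>w. incidence_row w \<bullet> P = of_bool (w = v) - of_bool (w = q)"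
proof -
  have "strongly_connected (with_proj G)"
    using G.symmetric_connected_imp_strongly_connected G.pair_sym_arcs conn by blast
  then have "q \<rightarrow>\<^sup>*\<^bsub>with_proj G\<^esub> v" using assms pverts_eq by (auto simp: strongly_connected_def)
  then have "(q, v) \<in> (parcs G)\<^sup>*" using reachable_rtranclI by force
  then show ?thesis
  proof (induction rule: rtrancl_induct)
    case base
    show ?case by (intro bexI[of _ "0\<^sub>v m"]) auto
  next
    case (step v w)
    then obtain P where P: "P \<in> carrier_vec m"
      "\<And>x. incidence_row x \<bullet> P = of_bool (x = v) - of_bool (x = q)" by blast
    have "(v, w) \<in> set es \<or> (w, v) \<in> set es"
      using orientation step(2) by (auto simp: enumerates_orientation_def)
    then obtain j where j: "j < m" "es ! j = (v, w) \<or> es ! j = (w, v)" by (metis in_set_conv_nth)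
    have unit: "incidence_row x \<bullet> unit_vec m j = incidence_row x $ j" for x
      using j by (simp add: scalar_prod_right_unit)
    from j(2) show ?case
    proof
      assume e: "es ! j = (v, w)"
      have "incidence_row x \<bullet> (P + unit_vec m j) = of_bool (x = w) - of_bool (x = q)" for x
        using j P by (simp add: scalar_prod_add_distrib[of _ m] unit e)
      then show ?thesis using P by (intro bexI[of _ "P + unit_vec m j"]) auto
    next
      assume e: "es ! j = (w, v)"
      have "incidence_row x \<bullet> (P - unit_vec m j) = of_bool (x = w) - of_bool (x = q)" for x
        using j P by (simp add: scalar_prod_minus_distrib[of _ m] unit e)
      then show ?thesis using P by (intro bexI[of _ "P - unit_vec m j"]) auto
    qed
  qed
qed

text \<open>With the potential normalised to 0 at the root, the omitted incidence row contributes
  nothing and the product is the full coboundary.\<close>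

lemma cut_matrix_mult_potential:
  assumes "h q = 0" "j < m"
  shows "(cut_matrix *\<^sub>v vec n (\<lambda>i. h (us ! i))) $ j = h (snd (es ! j)) - h (fst (es ! j))"
proof -
  have "(cut_matrix *\<^sub>v vec n (\<lambda>i. h (us ! i))) $ j = (\<Sum>i<n. incidence_row (us ! i) $ j * h (us ! i))"
    using assms(2) by (subst mult_mat_vec_nth_sum[OF cut_matrix_carrier])
      (auto simp: cut_matrix_def mat_of_cols_index intro!: sum.cong)
  also have "\<dots> = (\<Sum>v\<in>set us. incidence_row v $ j * h v)"
    using distinct_us by (intro sum.reindex_bij_betw bij_betw_nth) auto
  also have "\<dots> = (\<Sum>v\<in>pverts G. incidence_row v $ j * h v)"
    unfolding pverts_eq using root_notin assms(1) by simp
  also have "\<dots> = h (snd (es ! j)) - h (fst (es ! j))" by (rule sum_incidence_row[OF assms(2)])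
  finally show ?thesis .
qed

text \<open>All incidence rows sum to zero, so balance at the root follows from balance everywhere
  else.\<close>

lemma kernel_transpose_cut_matrix:
  assumes a: "a \<in> carrier_vec m" "transpose_mat cut_matrix *\<^sub>v a = 0\<^sub>v n"
  shows "a \<in> flow_lattice (q # us) es"
proof -
  have us: "incidence_row v \<bullet> a = 0" if v: "v \<in> set us" for v
  proof -
    obtain i where i: "i < n" "us ! i = v" using v by (metis in_set_conv_nth)
    have "(transpose_mat cut_matrix *\<^sub>v a) $ i = incidence_row v \<bullet> a"
      using i transpose_mult_vec_nth[OF cut_matrix_carrier i(1)] by simp
    then show ?thesis using a i by simp
  qed
  have "(\<Sum>v\<in>pverts G. incidence_row v \<bullet> a) = (\<Sum>j<m. (\<Sum>v\<in>pverts G. incidence_row v $ j * 1) * a $ j)"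
    using a(1) by (simp add: scalar_prod_def atLeast0LessThan sum_distrib_right) (rule sum.swap)
  also have "\<dots> = 0" by (intro sum.neutral ballI, subst sum_incidence_row) auto
  finally have "incidence_row q \<bullet> a = 0"
    using us root_notin unfolding pverts_eq by (simp add: sum.neutral)
  then show ?thesis using a us unfolding flow_lattice_iff pverts_eq by auto
qed

lemma transpose_cut_matrix_flow:
  assumes "f \<in> flow_lattice (q # us) es"
  shows "transpose_mat cut_matrix *\<^sub>v f = 0\<^sub>v n"
proof (intro eq_vecI)
  fix i assume "i < dim_vec (0\<^sub>v n :: int vec)"
  then have i: "i < n" by simp
  then have "us ! i \<in> pverts G" using pverts_eq by simp
  then show "(transpose_mat cut_matrix *\<^sub>v f) $ i = 0\<^sub>v n $ i"
    using assms i transpose_mult_vec_nth[OF cut_matrix_carrier i] by (simp add: flow_lattice_iff)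
qed (simp add: cut_matrix_def)

text \<open>Walks from the root to the other vertices have the unit vectors as reduced boundaries,
  so they form an integral right inverse.\<close>

lemma transpose_cut_matrix_surj:
  assumes d: "d \<in> carrier_vec n"
  shows "\<exists>a \<in> carrier_vec m. transpose_mat cut_matrix *\<^sub>v a = d"
proof -
  obtain P where P: "\<And>v. v \<in> pverts G \<Longrightarrow> P v \<in> carrier_vec m"
    "\<And>v w. v \<in> pverts G \<Longrightarrow> incidence_row w \<bullet> P v = of_bool (w = v) - of_bool (w = q)"
    using path_vector_exists by metis
  define M where "M = mat_of_cols m (map (\<lambda>u. P u) us)"
  have M: "M \<in> carrier_mat m n" unfolding M_def by (metis length_map mat_of_cols_carrier(1))
  have us: "us ! i \<in> pverts G" "us ! i \<noteq> q" if "i < n" for i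
    using that pverts_eq root_notin nth_mem[OF that] by auto
  have "transpose_mat cut_matrix * M = 1\<^sub>m n"
  proof (intro eq_matI)
    fix i k assume ik: "i < dim_row (1\<^sub>m n :: int mat)" "k < dim_col (1\<^sub>m n :: int mat)"
    then have "(transpose_mat cut_matrix * M) $$ (i, k) = incidence_row (us ! i) \<bullet> P (us ! k)"
      using M P(1)[OF us(1)[of k]] by (simp add: M_def cut_matrix_def)
    then show "(transpose_mat cut_matrix * M) $$ (i, k) = 1\<^sub>m n $$ (i, k)"
      using ik P(2)[OF us(1)[of k]] us(2)[of i] distinct_us by (simp add: nth_eq_iff_index_eq)
  qed (use M in \<open>auto simp: cut_matrix_def\<close>)
  then have "transpose_mat cut_matrix *\<^sub>v (M *\<^sub>v d) = d"
    using M d by (subst assoc_mult_mat_vec[symmetric, of _ n m _ n]) auto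
  moreover have "M *\<^sub>v d \<in> carrier_vec m" using M d by auto
  ultimately show ?thesis by blast
qed

text \<open>With \<open>P v\<close> a path from the root to \<open>v\<close>, closing each edge up by such paths gives flows
  \<open>F j\<close>, and every flow \<open>f\<close> equals \<open>\<Sum>j. f j * F j\<close>. So the closing map is a projection of the
  integer vectors onto the flow lattice, and no choice of a spanning tree is needed.\<close>

lemma flow_projection:
  obtains F :: "nat \<Rightarrow> int vec" and h :: "int vec \<Rightarrow> 'a \<Rightarrow> int" where
    "\<And>j. j < m \<Longrightarrow> F j \<in> flow_lattice (q # us) es"
    "\<And>f k. f \<in> flow_lattice (q # us) es \<Longrightarrow> k < m \<Longrightarrow> (\<Sum>j<m. F j $ k * f $ j) = f $ k"
    "\<And>a. a \<in> carrier_vec m \<Longrightarrow> (\<And>f. f \<in> flow_lattice (q # us) es \<Longrightarrow> f \<bullet> a = 0) \<Longrightarrow>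
      h a q = 0 \<and> (\<forall>j<m. a $ j = h a (snd (es ! j)) - h a (fst (es ! j)))"
proof -
  obtain P where P: "\<And>v. v \<in> pverts G \<Longrightarrow> P v \<in> carrier_vec m"
    "\<And>v w. v \<in> pverts G \<Longrightarrow> incidence_row w \<bullet> P v = of_bool (w = v) - of_bool (w = q)"
    using path_vector_exists by metis
  define F where "F j = unit_vec m j + (P (fst (es ! j)) - P (snd (es ! j)))" for j
  \<comment> \<open>The signed sum of \<open>a\<close> along the walk to \<open>v\<close>.
    Orthogonality to the closed walk \<open>F j\<close> makes its increment over edge
    \<open>j\<close> equal to \<open>a $ j\<close>.\<close>
  define h where "h a v = P v \<bullet> a" for a v
  have Pe: "P (fst (es ! j)) \<in> carrier_vec m" "P (snd (es ! j)) \<in> carrier_vec m" if "j < m" for j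
    using es_ends[OF that] P by auto
  have Fc: "F j \<in> carrier_vec m" if "j < m" for j using Pe[OF that] by (auto simp: F_def)
  have flow: "F j \<in> flow_lattice (q # us) es" if j: "j < m" for j
  proof -
    have "incidence_row w \<bullet> F j = 0" for w
      unfolding F_def using Pe[OF j] es_ends[OF j] j
      by (simp add: scalar_prod_add_distrib[of _ m] scalar_prod_minus_distrib[of _ m] P(2)
          scalar_prod_right_unit eq_commute)
    then show ?thesis using Fc[OF j] by (simp add: flow_lattice_iff)
  qed
  have proj: "(\<Sum>j<m. F j $ k * f $ j) = f $ k" if f: "f \<in> flow_lattice (q # us) es" and k: "k < m" for f k
  proof -
    \<comment> \<open>\<open>P\<close> enters \<open>F j\<close> as minus the coboundary of
      \<open>P v $ k\<close> in \<open>v\<close>. After exchanging the sums, the correction is a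
      combination of the net flows \<open>incidence_row v \<bullet> f\<close>, which vanish.\<close>
    have "(\<Sum>j<m. F j $ k * f $ j) =
      (\<Sum>j<m. of_bool (j = k) * f $ j - (\<Sum>v\<in>pverts G. incidence_row v $ j * P v $ k) * f $ j)"
    proof (intro sum.cong refl)
      fix j assume "j \<in> {..<m}"
      then have j: "j < m" by simp
      have "F j $ k = of_bool (j = k) + (P (fst (es ! j)) $ k - P (snd (es ! j)) $ k)"
        unfolding F_def using Pe[OF j] j k by simp
      then show "F j $ k * f $ j =
          of_bool (j = k) * f $ j - (\<Sum>v\<in>pverts G. incidence_row v $ j * P v $ k) * f $ j"
        by (simp only: sum_incidence_row[OF j, where h = "\<lambda>v. P v $ k"]) (simp add: algebra_simps)
    qed
    also have "\<dots> = f $ k - (\<Sum>j<m. \<Sum>v\<in>pverts G. P v $ k * (incidence_row v $ j * f $ j))"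
      using k by (simp add: sum_subtractf sum_distrib_right sum_distrib_left mult_ac of_bool_def
          if_distrib[where f = "(*) y" for y] cong: if_cong)
    also have "(\<Sum>j<m. \<Sum>v\<in>pverts G. P v $ k * (incidence_row v $ j * f $ j)) =
        (\<Sum>v\<in>pverts G. P v $ k * (incidence_row v \<bullet> f))"
      using f by (subst sum.swap)
        (simp add: scalar_prod_def atLeast0LessThan sum_distrib_left flow_lattice_iff[THEN iffD1, THEN conjunct1, THEN carrier_vecD])
    also have "\<dots> = 0" using f by (simp add: flow_lattice_iff)
    finally show ?thesis by simp
  qed
  have pot: "h a q = 0 \<and> (\<forall>j<m. a $ j = h a (snd (es ! j)) - h a (fst (es ! j)))"
    if a: "a \<in> carrier_vec m" and orth: "\<And>f. f \<in> flow_lattice (q # us) es \<Longrightarrow> f \<bullet> a = 0" for a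
  proof (intro conjI allI impI)
    have "q \<in> pverts G" using pverts_eq by simp
    \<comment> \<open>\<open>P q\<close> is a chosen closed walk, not necessarily the zero vector,
      but its boundary is zero.\<close>
    then have "P q \<in> flow_lattice (q # us) es" using P by (simp add: flow_lattice_iff)
    then show "h a q = 0" using orth by (simp add: h_def)
    fix j assume j: "j < m"
    have "F j \<bullet> a = a $ j + (h a (fst (es ! j)) - h a (snd (es ! j)))"
      unfolding F_def h_def using Pe[OF j] j a
      by (simp add: add_scalar_prod_distrib[of _ m] minus_scalar_prod_distrib[of _ m] scalar_prod_left_unit)
    then show "a $ j = h a (snd (es ! j)) - h a (fst (es ! j))" using orth[OF flow[OF j]] by simp
  qed
  show ?thesis using that[OF flow proj pot] .
qed

text \<open>Carries a vector indexed by positions in \<open>us\<close> over to the vertices; the sum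
  form extends it by 0 to the root.\<close>

definition potential :: "int vec \<Rightarrow> 'a \<Rightarrow> int" where
  "potential z v = (\<Sum>i<n. if us ! i = v then z $ i else 0)"

lemma potential_root [simp]: "potential z q = 0"
  using root_notin nth_mem[of _ us] by (auto simp: potential_def intro!: sum.neutral)

lemma potential_nth [simp]: "i < n \<Longrightarrow> potential z (us ! i) = z $ i"
  using distinct_us by (simp add: potential_def nth_eq_iff_index_eq cong: if_cong)

lemma potential_vec [simp]: "v \<in> set us \<Longrightarrow> potential (vec n (\<lambda>i. h (us ! i))) v = h v"
  by (metis index_vec in_set_conv_nth potential_nth)

lemma vec_potential: "z \<in> carrier_vec n \<Longrightarrow> vec n (\<lambda>i. potential z (us ! i)) = z"
  by (intro eq_vecI) auto

text \<open>Reversing an edge flips both its incidence sign and its coboundary, so either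
  orientation contributes \<open>h u - h w\<close>, and each neighbour occurs exactly once.\<close>

lemma sum_edges_at:
  assumes "u \<in> pverts G"
  shows "(\<Sum>j<m. incidence_row u $ j * (h (snd (es ! j)) - h (fst (es ! j)))) =
    (\<Sum>w | (u, w) \<in> parcs G. h u - h w)"
proof -
  have fin: "finite {w. (w, u) \<in> set es}" "finite {w. (u, w) \<in> set es}"
    by (rule finite_subset[of _ "fst ` set es"], force, simp, rule finite_subset[of _ "snd ` set es"], force, simp)
  have "(\<Sum>j<m. incidence_row u $ j * (h (snd (es ! j)) - h (fst (es ! j)))) =
    (\<Sum>j<m. (if snd (es ! j) = u then h u - h (fst (es ! j)) else 0)
      + (if fst (es ! j) = u then h u - h (snd (es ! j)) else 0))"
    by (intro sum.cong) auto
  also have "\<dots> = (\<Sum>e\<in>set es. (if snd e = u then h u - h (fst e) else 0)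
      + (if fst e = u then h u - h (snd e) else 0))"
    using orientation by (intro sum.reindex_bij_betw bij_betw_nth) (auto simp: enumerates_orientation_def)
  also have "\<dots> = (\<Sum>e\<in>{e \<in> set es. snd e = u}. h u - h (fst e)) + (\<Sum>e\<in>{e \<in> set es. fst e = u}. h u - h (snd e))"
    by (simp add: sum.distrib sum.inter_filter)
  also have "(\<Sum>e\<in>{e \<in> set es. snd e = u}. h u - h (fst e)) = (\<Sum>w | (w, u) \<in> set es. h u - h w)"
    by (rule sum.reindex_bij_witness[where i = "\<lambda>w. (w, u)" and j = fst]) auto
  also have "(\<Sum>e\<in>{e \<in> set es. fst e = u}. h u - h (snd e)) = (\<Sum>w | (u, w) \<in> set es. h u - h w)"
    by (rule sum.reindex_bij_witness[where i = "\<lambda>w. (u, w)" and j = snd]) auto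
  also have "(\<Sum>w | (w, u) \<in> set es. h u - h w) + (\<Sum>w | (u, w) \<in> set es. h u - h w) =
    (\<Sum>w\<in>{w. (w, u) \<in> set es} \<union> {w. (u, w) \<in> set es}. h u - h w)"
    using orientation fin by (intro sum.union_disjoint[symmetric]) (auto simp: enumerates_orientation_def)
  also have "{w. (w, u) \<in> set es} \<union> {w. (u, w) \<in> set es} = {w. (u, w) \<in> parcs G}"
    using orientation G.arcs_symmetric by (auto simp: enumerates_orientation_def)
  finally show ?thesis .
qed

abbreviation "reduced_laplacian \<equiv> transpose_mat cut_matrix * cut_matrix"

lemma reduced_laplacian_carrier: "reduced_laplacian \<in> carrier_mat n n"
  by (rule carrier_matI) simp_all

lemma reduced_laplacian_mult:
  assumes z: "z \<in> carrier_vec n" and i: "i < n"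
  shows "(reduced_laplacian *\<^sub>v z) $ i =
    (\<Sum>w | (us ! i, w) \<in> parcs G. potential z (us ! i) - potential z w)"
proof -
  have Kz: "(cut_matrix *\<^sub>v z) $ j = potential z (snd (es ! j)) - potential z (fst (es ! j))" if "j < m" for j
    using cut_matrix_mult_potential[of "potential z" j] that by (simp add: vec_potential[OF z])
  have "reduced_laplacian *\<^sub>v z = transpose_mat cut_matrix *\<^sub>v (cut_matrix *\<^sub>v z)"
    using z cut_matrix_carrier by (intro assoc_mult_mat_vec) auto
  then have "(reduced_laplacian *\<^sub>v z) $ i = incidence_row (us ! i) \<bullet> (cut_matrix *\<^sub>v z)"
    using transpose_mult_vec_nth[OF cut_matrix_carrier i] i by simp
  also have "\<dots> = (\<Sum>j<m. incidence_row (us ! i) $ j * (potential z (snd (es ! j)) - potential z (fst (es ! j))))"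
    unfolding scalar_prod_def using cut_matrix_carrier Kz
    by (intro sum.cong) (auto simp del: index_mult_mat_vec)
  also have "\<dots> = (\<Sum>w | (us ! i, w) \<in> parcs G. potential z (us ! i) - potential z w)"
    using i pverts_eq by (intro sum_edges_at) auto
  finally show ?thesis .
qed

lemma reduced_laplacian_Z:
  assumes "i < n" "k < n" "i \<noteq> k"
  shows "reduced_laplacian $$ (i, k) \<le> 0"
proof -
  have "us ! i \<noteq> us ! k" using assms distinct_us by (simp add: nth_eq_iff_index_eq)
  then have "incidence_row (us ! i) $ j * incidence_row (us ! k) $ j \<le> 0" if "j < m" for j
    using that by auto
  then have "incidence_row (us ! i) \<bullet> incidence_row (us ! k) \<le> 0"
    unfolding scalar_prod_def by (intro sum_nonpos) auto
  moreover have "reduced_laplacian $$ (i, k) = incidence_row (us ! i) \<bullet> incidence_row (us ! k)"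
    using assms cut_matrix_carrier by simp
  ultimately show ?thesis by simp
qed

section \<open>Parking functions as superstable configurations\<close>

lemma finite_neighbours: "finite {w. (u, w) \<in> parcs G \<and> P w}"
  by (rule finite_subset[OF _ G.pair_finite_verts]) (auto dest: G.in_arcsD2)

lemma card_boundary_edges:
  "card {w. w \<in> {q} \<union> (set us - A) \<and> (v, w) \<in> parcs G} = card {w. (v, w) \<in> parcs G \<and> w \<notin> A}"
  if "q \<notin> A"
  using that G.in_arcsD2[of v] pverts_eq by (intro arg_cong[where f = card]) auto

text \<open>Firing with multiplicities \<open>z\<close> is no better than firing the level set of its maximum,
  so it suffices to test indicator vectors.\<close>

lemma z_superstable_reduced_laplacian_iff:
  assumes c: "c \<in> carrier_vec n"
  shows "z_superstable reduced_laplacian c \<longleftrightarrow> (\<forall>i<n. c $ i \<ge> 0) \<and>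
    (\<forall>A\<subseteq>set us. A \<noteq> {} \<longrightarrow>
      (\<exists>v\<in>A. potential c v < int (card {w. w \<in> {q} \<union> (set us - A) \<and> (v, w) \<in> parcs G})))"
    (is "?L \<longleftrightarrow> ?N \<and> ?R")
proof (intro iffI conjI)
  have dim: "dim_row reduced_laplacian = n" using reduced_laplacian_carrier by (rule carrier_matD)
  assume L: ?L
  then show ?N using z_superstableD(2)[OF _ reduced_laplacian_carrier] by blast
  show ?R
  proof (intro allI impI)
    fix A assume A: "A \<subseteq> set us" "A \<noteq> {}"
    then have qA: "q \<notin> A" using root_notin by auto
    define z :: "int vec" where "z = vec n (\<lambda>i. of_bool (us ! i \<in> A))"
    have z: "z \<in> carrier_vec n" "z \<ge> 0\<^sub>v n" by (auto simp: z_def less_eq_vec_def)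
    obtain v where "v \<in> A" using A by blast
    then obtain k where k: "k < n" "us ! k \<in> A" using A by (metis in_set_conv_nth subsetD)
    then have "z $ k \<noteq> 0" by (simp add: z_def)
    then have "z \<noteq> 0\<^sub>v n" using k by auto
    then obtain i where i: "i < n" "c $ i - (reduced_laplacian *\<^sub>v z) $ i < 0"
      using L z unfolding z_superstable_def dim by blast
    have pz: "potential z w = of_bool (w \<in> A)" if "w \<in> pverts G" for w
      using that qA unfolding pverts_eq z_def
      by (auto simp del: of_bool_eq(1) simp: potential_vec[where h = "\<lambda>w. of_bool (w \<in> A)"])
    have Lz: "(reduced_laplacian *\<^sub>v z) $ i =
        (\<Sum>w | (us ! i, w) \<in> parcs G. of_bool (us ! i \<in> A) - of_bool (w \<in> A))"
      unfolding reduced_laplacian_mult[OF z(1) i(1)]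
      using pz i(1) G.in_arcsD2 by (intro sum.cong refl arg_cong2[where f = "(-)"]) (auto simp: pverts_eq simp del: potential_nth)
    have "c $ i \<ge> 0" using \<open>?N\<close> i by simp
    \<comment> \<open>A vertex outside \<open>A\<close> loses nothing when \<open>A\<close> fires,
      so the index where superstability makes an entry negative lies in \<open>A\<close>.\<close>
    have iA: "us ! i \<in> A"
    proof (rule ccontr)
      assume "us ! i \<notin> A"
      then have "(reduced_laplacian *\<^sub>v z) $ i \<le> 0" unfolding Lz by (intro sum_nonpos) auto
      then show False using i \<open>c $ i \<ge> 0\<close> by simp
    qed
    have "(reduced_laplacian *\<^sub>v z) $ i = (\<Sum>w | (us ! i, w) \<in> parcs G. if w \<notin> A then 1 else 0)"
      unfolding Lz using iA by (intro sum.cong) auto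
    also have "\<dots> = int (card {w. (us ! i, w) \<in> parcs G \<and> w \<notin> A})"
      using finite_neighbours[of "us ! i" "\<lambda>_. True"] by (subst sum.inter_filter[symmetric]) auto
    finally show "\<exists>v\<in>A. potential c v < int (card {w. w \<in> {q} \<union> (set us - A) \<and> (v, w) \<in> parcs G})"
      using i iA unfolding card_boundary_edges[OF qA] by (intro bexI[of _ "us ! i"]) auto
  qed
next
  have dim: "dim_row reduced_laplacian = n" using reduced_laplacian_carrier by (rule carrier_matD)
  assume NR: "?N \<and> ?R"
  show ?L
    unfolding z_superstable_def dim
  proof (intro conjI ballI impI)
    show "c \<in> carrier_vec n" by (rule c)
    show "0\<^sub>v n \<le> c" using NR c by (auto simp: less_eq_vec_def)
    fix z :: "int vec" assume z: "z \<in> carrier_vec n" and z0: "0\<^sub>v n \<le> z \<and> z \<noteq> 0\<^sub>v n"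
    have zn: "z $ i \<ge> 0" if "i < n" for i using z0 z that by (auto simp: less_eq_vec_def)
    obtain k where k: "k < n" "z $ k \<noteq> 0" using z0 z by (metis carrier_vecD eq_vecI index_zero_vec)
    define M where "M = Max (potential z ` set us)"
    have le: "potential z v \<le> M" if "v \<in> set us" for v unfolding M_def using that by simp
    have "0 < potential z (us ! k)" using k zn[of k] by simp
    then have M: "M > 0" using le[of "us ! k"] k by simp
    define A where "A = {v \<in> set us. potential z v = M}"
    have "M \<in> potential z ` set us" unfolding M_def using k by (intro Max_in) auto
    then have A: "A \<subseteq> set us" "A \<noteq> {}" unfolding A_def by auto
    then have qA: "q \<notin> A" using root_notin by auto
    obtain v where v: "v \<in> A" "potential c v < int (card {w. (v, w) \<in> parcs G \<and> w \<notin> A})"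
      using NR A unfolding card_boundary_edges[OF qA, symmetric] by blast
    then obtain i where i: "i < n" "us ! i = v" using A by (metis in_set_conv_nth subsetD)
    have "int (card {w. (v, w) \<in> parcs G \<and> w \<notin> A}) = (\<Sum>w | (v, w) \<in> parcs G. if w \<notin> A then 1 else 0)"
      using finite_neighbours[of v "\<lambda>_. True"] by (subst sum.inter_filter[symmetric]) auto
    \<comment> \<open>By integrality a neighbour outside \<open>A\<close> has potential at most
      \<open>M - 1\<close>; for the root, with potential 0, this is \<open>M > 0\<close>.\<close>
    also have "\<dots> \<le> (\<Sum>w | (v, w) \<in> parcs G. potential z v - potential z w)"
    proof (intro sum_mono)
      fix w assume "w \<in> {w. (v, w) \<in> parcs G}"
      then have "w \<in> pverts G" using G.in_arcsD2 by blast
      moreover have "potential z v = M" using v by (simp add: A_def)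
      ultimately show "(if w \<notin> A then 1 else 0) \<le> potential z v - potential z w"
        using le[of w] M unfolding pverts_eq A_def by (cases "w = q") auto
    qed
    also have "\<dots> = (reduced_laplacian *\<^sub>v z) $ i"
      using reduced_laplacian_mult[OF z i(1)] i by simp
    finally show "\<exists>i<n. c $ i - (reduced_laplacian *\<^sub>v z) $ i < 0"
      using v(2) i potential_nth[OF i(1), of c] by (intro exI[of _ i]) auto
  qed
qed

text \<open>A vertex with value \<open>x\<close> burns once more than \<open>x\<close> of its
  neighbours do. The fire starts at the root, and \<open>R = {}\<close> imposes nothing because no
  value is below 0.\<close>

lemma card_z_superstable_reduced_laplacian:
  "card {c. z_superstable reduced_laplacian c} =
    card (burning_maps (\<lambda>v x S. x < card {w. w \<in> S \<and> (v, w) \<in> parcs G}) {} {q} (set us))"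
    (is "card ?X = card (burning_maps ?f {} {q} (set us))")
proof (rule bij_betw_same_card[OF bij_betwI[where
      f = "\<lambda>c. restrict (\<lambda>v. nat (potential c v)) (set us)" and g = "\<lambda>x. vec n (\<lambda>i. int (x (us ! i)))"]])
  let ?Y = "burning_maps ?f {} {q} (set us)"
  have X: "c \<in> carrier_vec n" "z_superstable reduced_laplacian c" if "c \<in> ?X" for c
    using that z_superstableD(1)[OF _ reduced_laplacian_carrier] by auto
  have nonneg: "potential c v \<ge> 0" if c: "c \<in> ?X" and v: "v \<in> set us" for c v
  proof -
    obtain i where i: "i < n" "us ! i = v" using v by (metis in_set_conv_nth)
    have "c $ i \<ge> 0" by (rule z_superstableD(2)[OF X(2)[OF c] reduced_laplacian_carrier i(1)])
    then show ?thesis using potential_nth[OF i(1), of c] i(2) by simp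
  qed
  show "(\<lambda>c. restrict (\<lambda>v. nat (potential c v)) (set us)) \<in> ?X \<rightarrow> ?Y"
  proof
    fix c assume c: "c \<in> ?X"
    show "restrict (\<lambda>v. nat (potential c v)) (set us) \<in> ?Y"
    proof (rule burning_mapsI)
      fix A assume A: "A \<subseteq> set us" "A \<noteq> {}"
      then obtain v where v: "v \<in> A" "potential c v < int (card {w. w \<in> {q} \<union> (set us - A) \<and> (v, w) \<in> parcs G})"
        using X(2)[OF c] unfolding z_superstable_reduced_laplacian_iff[OF X(1)[OF c]] by blast
      then have "v \<in> set us" using A by blast
      then show "\<exists>v\<in>A. restrict (\<lambda>v. nat (potential c v)) (set us) v
          < card {w. w \<in> {q} \<union> (set us - A) \<and> (v, w) \<in> parcs G}"
        using v nonneg[OF c] by (intro bexI[of _ v]) (simp_all add: nat_less_iff)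
    qed auto
  qed
  show "(\<lambda>x. vec n (\<lambda>i. int (x (us ! i)))) \<in> ?Y \<rightarrow> ?X"
  proof
    fix x assume x: "x \<in> ?Y"
    let ?c = "vec n (\<lambda>i. int (x (us ! i)))"
    have "\<exists>v\<in>A. potential ?c v < int (card {w. w \<in> {q} \<union> (set us - A) \<and> (v, w) \<in> parcs G})"
      if A: "A \<subseteq> set us" "A \<noteq> {}" for A
    proof -
      obtain v where v: "v \<in> A" "x v < card {w. w \<in> {q} \<union> (set us - A) \<and> (v, w) \<in> parcs G}"
        using burning_mapsD(3)[OF x A] by blast
      moreover have "potential ?c v = int (x v)" using v A by (intro potential_vec) blast
      ultimately show ?thesis by (intro bexI[of _ v]) simp_all
    qed
    then have "z_superstable reduced_laplacian ?c"
      by (subst z_superstable_reduced_laplacian_iff) simp_all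
    then show "?c \<in> ?X" by simp
  qed
  show "vec n (\<lambda>i. int (restrict (\<lambda>v. nat (potential c v)) (set us) (us ! i))) = c" if "c \<in> ?X" for c
    using X(1)[OF that] nonneg[OF that] by (intro eq_vecI) (auto simp: nth_mem simp del: potential_nth, simp)
  show "restrict (\<lambda>v. nat (potential (vec n (\<lambda>i. int (x (us ! i)))) v)) (set us) = x" if "x \<in> ?Y" for x
    using burning_mapsD(1)[OF that] potential_vec[where h = "\<lambda>v. int (x v)"]
    by (auto simp: fun_eq_iff extensional_def)
qed

text \<open>Singletons in Dhar's criterion give adjacency to the parent, arbitrary sets give
  acyclicity.\<close>

lemma parent_map_of_burning:
  assumes p: "p \<in> burning_maps (\<lambda>v u S. u \<in> S \<and> (v, u) \<in> parcs G) {} {q} (set us)"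
  shows "parent_map (pverts G) q p" and "v \<in> set us \<Longrightarrow> (v, p v) \<in> parcs G"
proof -
  have arc: "p v \<in> pverts G \<and> (v, p v) \<in> parcs G" if "v \<in> set us" for v
    using burning_mapsD(3)[OF p, of "{v}"] that pverts_eq by auto
  then show "v \<in> set us \<Longrightarrow> (v, p v) \<in> parcs G" by blast
  have U: "pverts G - {q} = set us" using pverts_eq root_notin by auto
  show "parent_map (pverts G) q p"
  proof
    show "finite (pverts G)" by (rule G.pair_finite_verts)
    show "q \<in> pverts G" using pverts_eq by simp
    show "p v \<in> pverts G" if "v \<in> pverts G - {q}" for v using arc that U by blast
    show "\<exists>v\<in>A. p v \<notin> A" if A: "A \<subseteq> pverts G - {q}" "A \<noteq> {}" for A
      using burning_mapsD(3)[OF p, of A] A root_notin unfolding U by blast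
  qed
qed

lemma card_spanning_trees:
  "card (burning_maps (\<lambda>v u S. u \<in> S \<and> (v, u) \<in> parcs G) {} {q} (set us)) = card (spanning_trees G)"
proof (rule bij_betw_same_card[of "parent_graph (pverts G) q"])
  let ?Y = "burning_maps (\<lambda>v u S. u \<in> S \<and> (v, u) \<in> parcs G) {} {q} (set us)"
  have U: "pverts G - {q} = set us" using pverts_eq root_notin by auto
  have "inj_on (parent_graph (pverts G) q) ?Y"
  proof (rule inj_onI)
    fix p p' assume p: "p \<in> ?Y" "p' \<in> ?Y" "parent_graph (pverts G) q p = parent_graph (pverts G) q p'"
    show "p = p'"
    proof (rule extensionalityI[OF burning_mapsD(1)[OF p(1)] burning_mapsD(1)[OF p(2)]])
      fix v assume "v \<in> set us"
      then show "p v = p' v"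
        using parent_graph_inj[OF parent_map_of_burning(1)[OF p(1)] parent_map_of_burning(1)[OF p(2)] p(3)] U
        by blast
    qed
  qed
  moreover have "parent_graph (pverts G) q p \<in> spanning_trees G" if p: "p \<in> ?Y" for p
  proof -
    interpret P: parent_map "pverts G" q p by (rule parent_map_of_burning(1)[OF p])
    interpret PH: pair_graph P.H by (rule P.pair_graph_parent_graph)
    have "parcs P.H \<subseteq> parcs G"
      using parent_map_of_burning(2)[OF p] G.arcs_symmetric U unfolding parent_graph_def by auto
    then show ?thesis
      unfolding spanning_trees_def spanning_def subgraph_def
      using P.undirected_tree_parent_graph G.wf_digraph PH.wf_digraph by auto
  qed
  moreover have "T \<in> parent_graph (pverts G) q ` ?Y" if T: "T \<in> spanning_trees G" for T
  proof -
    have TV: "pverts T = pverts G" and sub: "parcs T \<subseteq> parcs G" and tree: "undirected_tree T"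
      using T by (auto simp: spanning_trees_def spanning_def subgraph_def)
    then obtain p where p: "parent_map (pverts G) q p" "parent_graph (pverts G) q p = T"
      using undirected_tree_parent_map[of T q] pverts_eq by auto
    interpret P: parent_map "pverts G" q p by (rule p(1))
    \<comment> \<open>Burning maps are extensional; the restriction changes \<open>p\<close> only
      outside the non-root vertices, where \<open>parent_graph\<close> does not evaluate it.\<close>
    let ?p = "restrict p (set us)"
    have "?p \<in> ?Y"
    proof (rule burning_mapsI)
      fix A assume A: "A \<subseteq> set us" "A \<noteq> {}"
      then obtain v where v: "v \<in> A" "p v \<notin> A" using P.parent_acyclic[of A] U by blast
      then have vU: "v \<in> set us" using A by blast
      have "p v \<in> pverts G" using P.parent_in[of v] vU U by blast
      moreover have "(v, p v) \<in> parcs G"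
        using P.parent_graph_arcs[of v "p v"] vU U sub p(2) by blast
      ultimately show "\<exists>v\<in>A. ?p v \<in> {q} \<union> (set us - A) \<and> (v, ?p v) \<in> parcs G"
        using v vU pverts_eq by (intro bexI[of _ v]) auto
    qed auto
    moreover have "parent_graph (pverts G) q ?p = T"
      unfolding p(2)[symmetric] parent_graph_def U by (auto simp: image_def)
    ultimately show ?thesis by blast
  qed
  ultimately show "bij_betw (parent_graph (pverts G) q) ?Y (spanning_trees G)"
    unfolding bij_betw_def by blast
qed

text \<open>For both predicates the number of values that ignite \<open>v\<close> is the number of
  its neighbours in \<open>S\<close>: the thresholds below that number, and the burnt neighbours
  eligible as parents.\<close>

lemma card_z_superstable_spanning_trees:
  "card {c. z_superstable reduced_laplacian c} = card (spanning_trees G)"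
  unfolding card_z_superstable_reduced_laplacian card_spanning_trees[symmetric]
proof (rule card_burning_maps_cong)
  show "x < card {w. w \<in> T \<and> (v, w) \<in> parcs G}"
    if "x < card {w. w \<in> S \<and> (v, w) \<in> parcs G}" "S \<subseteq> T" for v and x :: nat and S T
  proof -
    have "card {w. w \<in> S \<and> (v, w) \<in> parcs G} \<le> card {w. w \<in> T \<and> (v, w) \<in> parcs G}"
      using that(2) finite_neighbours[of v "\<lambda>w. w \<in> T"] by (intro card_mono) (auto simp: conj_commute)
    then show ?thesis using that(1) by simp
  qed
  show "finite {u. u \<in> S \<and> (v, u) \<in> parcs G}" for v S
    using finite_neighbours[of v "\<lambda>w. w \<in> S"] by (simp add: conj_commute)
qed auto

lemma card_z_superstable_flow_basis:
  assumes basis: "is_int_basis m (flow_lattice (q # us) es) fs"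
    and Z: "Z_matrix (map_mat real_of_int (dual_laplacian m fs))"
  shows "card {c. z_superstable (dual_laplacian m fs) c} = card {c. z_superstable reduced_laplacian c}"
proof -
  let ?F = "flow_lattice (q # us) es"
  define A where "A = mat_of_cols m fs"
  let ?g = "length fs"
  have A: "A \<in> carrier_mat m ?g" unfolding A_def by simp
  have fs: "fs ! i \<in> ?F" if "i < ?g" for i using basis that nth_mem[of i fs] by (auto simp: is_int_basis_def)
  have ex: "\<exists>!x. x \<in> carrier_vec ?g \<and> f = A *\<^sub>v x" if "f \<in> ?F" for f
    using basis that unfolding is_int_basis_def A_def by blast
  have colA: "col A i = fs ! i" if "i < ?g" for i
    using fs[OF that] that unfolding A_def by (intro col_mat_of_cols) (auto simp: flow_lattice_iff)
  have AF: "A *\<^sub>v x \<in> ?F" if x: "x \<in> carrier_vec ?g" for x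
    unfolding flow_lattice_iff
  proof (intro conjI ballI)
    show "A *\<^sub>v x \<in> carrier_vec m" using A x by simp
    fix v assume v: "v \<in> pverts G"
    have "incidence_row v \<bullet> (A *\<^sub>v x) = (transpose_mat A *\<^sub>v incidence_row v) \<bullet> x"
      by (rule transpose_vec_mult_scalar[OF A x incidence_row_carrier, symmetric])
    also have "transpose_mat A *\<^sub>v incidence_row v = 0\<^sub>v ?g"
    proof (intro eq_vecI)
      fix i assume "i < dim_vec (0\<^sub>v ?g :: int vec)"
      then have i: "i < ?g" by simp
      have "(transpose_mat A *\<^sub>v incidence_row v) $ i = fs ! i \<bullet> incidence_row v"
        using transpose_mult_vec_nth[OF A i] colA[OF i] by simp
      also have "\<dots> = incidence_row v \<bullet> fs ! i"
        using fs[OF i] by (intro comm_scalar_prod[of _ m]) (auto simp: flow_lattice_iff)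
      finally show "(transpose_mat A *\<^sub>v incidence_row v) $ i = 0\<^sub>v ?g $ i"
        using fs[OF i] v i by (simp add: flow_lattice_iff)
    qed (use A in simp)
    finally show "incidence_row v \<bullet> (A *\<^sub>v x) = 0" using x by simp
  qed
  obtain F h where F: "\<And>j. j < m \<Longrightarrow> F j \<in> ?F"
    and proj: "\<And>f k. f \<in> ?F \<Longrightarrow> k < m \<Longrightarrow> (\<Sum>j<m. F j $ k * f $ j) = f $ k"
    and pot: "\<And>a. a \<in> carrier_vec m \<Longrightarrow> (\<And>f. f \<in> ?F \<Longrightarrow> f \<bullet> a = 0) \<Longrightarrow>
      h a q = (0::int) \<and> (\<forall>j<m. a $ j = h a (snd (es ! j)) - h a (fst (es ! j)))"
    using flow_projection by blast
  obtain u where u: "\<And>j. j < m \<Longrightarrow> u j \<in> carrier_vec ?g \<and> F j = A *\<^sub>v u j"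
    using ex[OF F] by metis
  \<comment> \<open>Column \<open>j\<close> holds the basis coordinates of \<open>F j\<close>, so
    \<open>A * U\<close> is the projection onto the flow lattice.\<close>
  define U where "U = mat_of_cols ?g (map u [0..<m])"
  have U: "U \<in> carrier_mat ?g m" unfolding U_def by (intro carrier_matI) simp_all
  have AU: "A *\<^sub>v (U *\<^sub>v f) = f" if f: "f \<in> ?F" for f
  proof (intro eq_vecI)
    have fc: "f \<in> carrier_vec m" using f by (simp add: flow_lattice_iff)
    fix k assume "k < dim_vec f"
    then have k: "k < m" using fc by simp
    have AUc: "A * U \<in> carrier_mat m m" using A U by simp
    have entry: "(A * U) $$ (k, j) = F j $ k" if j: "j < m" for j
    proof -
      have "col U j = u j" using u[OF j] j unfolding U_def by (subst col_mat_of_cols) auto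
      then have "(A * U) $$ (k, j) = row A k \<bullet> u j" using A U k j by simp
      also have "\<dots> = F j $ k" using u[OF j] A k by simp
      finally show ?thesis .
    qed
    have "A *\<^sub>v (U *\<^sub>v f) = (A * U) *\<^sub>v f" by (rule assoc_mult_mat_vec[OF A U fc, symmetric])
    then have "(A *\<^sub>v (U *\<^sub>v f)) $ k = (\<Sum>j<m. F j $ k * f $ j)"
      using mult_mat_vec_nth_sum[OF AUc fc k] entry by simp
    then show "(A *\<^sub>v (U *\<^sub>v f)) $ k = f $ k" using proj[OF f k] by simp
  qed (use A that in \<open>auto simp: flow_lattice_iff\<close>)
  \<comment> \<open>Uniqueness of coordinates turns the identity \<open>A U = 1\<close> on flows
    into \<open>U A = 1\<close> on coordinate vectors.\<close>
  have UA: "U *\<^sub>v (A *\<^sub>v x) = x" if x: "x \<in> carrier_vec ?g" for x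
  proof -
    have "U *\<^sub>v (A *\<^sub>v x) \<in> carrier_vec ?g" using U by (intro carrier_vecI) simp
    then show ?thesis using ex[OF AF[OF x]] AU[OF AF[OF x]] x by metis
  qed
  have dual: "dual_laplacian m fs = transpose_mat A * A" by (simp add: dual_laplacian_def A_def)
  show ?thesis
    unfolding dual
  proof (rule card_z_superstable_dual[OF A cut_matrix_carrier])
    show "transpose_mat cut_matrix *\<^sub>v (A *\<^sub>v z) = 0\<^sub>v n" if "z \<in> carrier_vec ?g" for z
      using transpose_cut_matrix_flow[OF AF[OF that]] .
    show "\<exists>a\<in>carrier_vec m. transpose_mat A *\<^sub>v a = d" if d: "d \<in> carrier_vec ?g" for d
      using transpose_retraction[OF A U UA d] U
      by (intro bexI[of _ "transpose_mat U *\<^sub>v d"]) (auto intro!: carrier_vecI)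
    show "\<exists>a\<in>carrier_vec m. transpose_mat cut_matrix *\<^sub>v a = d" if "d \<in> carrier_vec n" for d
      using transpose_cut_matrix_surj[OF that] .
    show "\<exists>z\<in>carrier_vec n. a = cut_matrix *\<^sub>v z"
      if a: "a \<in> carrier_vec m" "transpose_mat A *\<^sub>v a = 0\<^sub>v ?g" for a
    proof -
      have "f \<bullet> a = 0" if f: "f \<in> ?F" for f
      proof -
        obtain x where x: "x \<in> carrier_vec ?g" "f = A *\<^sub>v x" using ex[OF f] by blast
        have "f \<bullet> a = a \<bullet> f" using f a by (intro comm_scalar_prod[of _ m]) (auto simp: flow_lattice_iff)
        also have "\<dots> = (transpose_mat A *\<^sub>v a) \<bullet> x"
          unfolding x(2) by (rule transpose_vec_mult_scalar[OF A x(1) a(1), symmetric])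
        also have "\<dots> = 0" using a(2) x(1) by simp
        finally show ?thesis .
      qed
      \<comment> \<open>The integer values of the potential at the non-root vertices are the
        coefficients of \<open>a\<close> in the cut lattice.\<close>
      from pot[OF a(1) this] have "a = cut_matrix *\<^sub>v vec n (\<lambda>i. h a (us ! i))"
        using a(1) by (intro eq_vecI)
          (auto simp: cut_matrix_mult_potential simp del: index_mult_mat_vec)
      then show ?thesis by (intro bexI[of _ "vec n (\<lambda>i. h a (us ! i))"]) auto
    qed
    show "\<exists>z\<in>carrier_vec ?g. a = A *\<^sub>v z"
      if "a \<in> carrier_vec m" "transpose_mat cut_matrix *\<^sub>v a = 0\<^sub>v n" for a
      using ex[OF kernel_transpose_cut_matrix[OF that]] by blast
    show "(transpose_mat A * A) $$ (i, j) \<le> 0" if "i < ?g" "j < ?g" "i \<noteq> j" for i j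
      using Z A that unfolding Z_matrix_def dual by (auto simp del: index_mult_mat(1))
    show "reduced_laplacian $$ (i, j) \<le> 0" if "i < n" "j < n" "i \<noteq> j" for i j
      using reduced_laplacian_Z[OF that] .
  qed
qed

end

theorem proposition3p14:
  fixes G :: "'a pair_pre_digraph"
    and vs :: "'a list" and es :: "('a \<times> 'a) list" and fs :: "int vec list"
  assumes "pair_graph G" and "Digraph_Component.connected (with_proj G)"
    and "enumerates_vertices vs G" and "enumerates_orientation es G"
    and "integral_flow_M_basis vs es fs"
  shows "card {c. z_superstable (dual_laplacian (length es) fs) c} = card (spanning_trees G)"
proof -
  \<comment> \<open>Connectedness includes having a vertex, which provides the root.\<close>
  have "pverts G \<noteq> {}" using assms(2) by (auto simp: connected_conv)
  then obtain q us where vs: "vs = q # us"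
    using assms(3) by (cases vs) (auto simp: enumerates_vertices_def)
  interpret oriented_graph G q us es
    using assms(1-4) unfolding vs by (rule oriented_graph.intro)
  show ?thesis
    using card_z_superstable_flow_basis[of fs] card_z_superstable_spanning_trees assms(5)
    unfolding vs integral_flow_M_basis_def M_matrix_def by simp
qed

end
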